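(* Let $\sigma>0$ and suppose that $f$ is a solution of the Riccati equation $\sigma xf'-\sigma f+\frac12f^2+2\sigma\mu x^2=\frac12Ax^2+Bx+C$ with $A>0$. Then there is a fundamental solution of the PDE $$u_t=\sigma xu_{xx}+f(x)u_x-\mu xu,\qquad x\ge0,$$ of the form $$p(t,x,y)=\frac{\sqrt{Axy}\,e^{-(F(x)-F(y))/(2\sigma)}}{2\sigma\sinh(\sqrt At/2)}\exp\left(-\frac{Bt}{2\sigma}-\frac{\sqrt A(x+y)}{2\sigma\tanh(\sqrt At/2)}\right)\left(C_1(y)I_\nu\left(\frac{\sqrt{Axy}}{\sigma\sinh(\sqrt At/2)}\right)+C_2(y)I_{-\nu}\left(\frac{\sqrt{Axy}}{\sigma\sinh(\sqrt At/2)}\right)\right)$$ for some functions $C_1(y),C_2(y)$, where $F'(x)=f(x)/x$, $\nu=\frac{\sqrt{\sigma^2+2C}}{\sigma}$ and $I_{-\nu}(z)$ is interpreted as $K_\nu(z)$ if $\nu$ is an integer.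
   Context: $I_\nu,K_\nu$ are the modified Bessel functions of the first and second kind. A fundamental solution of the PDE is a kernel $p(t,x,y)$, $t>0$, $x,y\ge 0$, such that for suitable initial data $\varphi$ (e.g. continuous with compact support in $(0,\infty)$) the function $u(x,t)=\int_0^\infty\varphi(y)p(t,x,y)\,dy$ solves the PDE for $t>0$ and satisfies $u(x,0)=\varphi(x)$. Fundamental solutions need not be unique. *)

theory Defs
  imports "HOL-Analysis.Analysis"
begin

text \<open>
  Modified Bessel functions of real order and positive real argument. Using \<^const>\<open>rGamma\<close>
  (the entire reciprocal of \<^const>\<open>Gamma\<close>) gives the correct vanishing terms at negative
  integer orders.
\<close>

definition bessel_I :: "real \<Rightarrow> real \<Rightarrow> real" where
  "bessel_I \<nu> z = (z / 2) powr \<nu> *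
     (\<Sum>k. rGamma (real k + \<nu> + 1) / fact k * (z\<^sup>2 / 4) ^ k)"

definition bessel_K :: "real \<Rightarrow> real \<Rightarrow> real" where
  "bessel_K \<nu> z =
     (let q = (\<lambda>\<alpha>. pi / 2 * (bessel_I (- \<alpha>) z - bessel_I \<alpha> z) / sin (\<alpha> * pi))
      in if \<nu> \<in> \<int> then Lim (at \<nu>) q else q \<nu>)"

text \<open>The second solution \<open>I\<^sub>-\<^sub>\<nu>\<close>, read as \<open>K\<^sub>\<nu>\<close> when \<open>\<nu>\<close> is an integer.\<close>

definition bessel_I_neg :: "real \<Rightarrow> real \<Rightarrow> real" where
  "bessel_I_neg \<nu> z = (if \<nu> \<in> \<int> then bessel_K \<nu> z else bessel_I (- \<nu>) z)"

text \<open>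
  Classical solutions of \<open>u\<^sub>t = \<sigma> x u\<^sub>x\<^sub>x + f(x) u\<^sub>x - \<mu> x u\<close> for \<open>t > 0\<close>. The operator degenerates
  at the endpoint \<open>x = 0\<close>, where \<open>f\<close> need not even be defined, so the equation is
  imposed on \<open>x > 0\<close>.
\<close>

definition solves_pde ::
  "real \<Rightarrow> (real \<Rightarrow> real) \<Rightarrow> real \<Rightarrow> (real \<Rightarrow> real \<Rightarrow> real) \<Rightarrow> bool" where
  "solves_pde \<sigma> f \<mu> u \<longleftrightarrow>
     (\<exists>ut ux uxx. \<forall>t>0. \<forall>x>0.
        ((\<lambda>s. u s x) has_real_derivative ut t x) (at t) \<and>
        ((\<lambda>z. u t z) has_real_derivative ux t x) (at x) \<and>
        ((\<lambda>z. ux t z) has_real_derivative uxx t x) (at x) \<and>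
        ut t x = \<sigma> * x * uxx t x + f x * ux t x - \<mu> * x * u t x)"

text \<open>
  Initial data: continuous functions with compact support in \<open>(0,\<infinity>)\<close>. The initial condition
  \<open>u(x,0) = \<phi>(x)\<close> is attained continuously, i.e. as a joint limit \<open>(t,x) \<rightarrow> (0+,x\<^sub>0)\<close>.
\<close>

definition test_function :: "(real \<Rightarrow> real) \<Rightarrow> bool" where
  "test_function \<phi> \<longleftrightarrow>
     continuous_on {0<..} \<phi> \<and>
     (\<exists>K. compact K \<and> K \<subseteq> {0<..} \<and> (\<forall>y. y \<notin> K \<longrightarrow> \<phi> y = 0))"

definition fundamental_solution ::
  "real \<Rightarrow> (real \<Rightarrow> real) \<Rightarrow> real \<Rightarrow> (real \<Rightarrow> real \<Rightarrow> real \<Rightarrow> real) \<Rightarrow> bool" where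
  "fundamental_solution \<sigma> f \<mu> p \<longleftrightarrow>
     (\<forall>\<phi>. test_function \<phi> \<longrightarrow>
        (let u = (\<lambda>t x. LINT y:{0<..}|lborel. \<phi> y * p t x y) in
          (\<forall>t>0. \<forall>x>0. set_integrable lborel {0<..} (\<lambda>y. \<phi> y * p t x y)) \<and>
          solves_pde \<sigma> f \<mu> u \<and>
          (\<forall>x0>0. ((\<lambda>(t, x). u t x) \<longlongrightarrow> \<phi> x0) (at (0, x0) within {0<..} \<times> {0<..}))))"

end

theory Submission
  imports Defs
begin

text \<open>
  We take \<open>C1 y = 1 / y\<close> and \<open>C2 = 0\<close>. The substitution \<open>u = exp (- F / (2 * \<sigma>)) * v\<close> and the Riccati
  equation turn the PDE into \<open>v\<^sub>t = \<sigma> x v\<^sub>x\<^sub>x - (A x / (4 \<sigma>) + B / (2 \<sigma>) + C / (2 \<sigma> x)) v\<close>, which the kernel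
  satisfies pointwise because \<open>G(w) = w\<^bsup>(1+\<nu>)/2\<^esup> \<Sum> w\<^sup>k / (k! \<Gamma>(k+\<nu>+1))\<close> solves
  \<open>G'' = (1 / w + (\<nu>\<^sup>2 - 1) / (4 w\<^sup>2)) G\<close>; one then differentiates under the integral sign.
  For the initial condition no asymptotics of Bessel functions are needed: up to factors continuous
  in \<open>x\<close> and \<open>y\<close>, the kernel in \<open>y\<close> is a Poisson mixture of Gamma densities, whose first three
  moments (of orders 0, 1, 2) are explicit, so its mass tends to \<open>1\<close> and it concentrates at \<open>x\<^sub>0\<close> by Chebyshev's inequality.
  The order \<open>\<nu>\<close> is real and nonnegative because for \<open>\<sigma>\<^sup>2 + 2 C < 0\<close> every solution of the Riccati
  equation blows up infinitely often near \<open>0\<close>.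
\<close>

subsection \<open>The Riccati equation near zero\<close>

text \<open>Completing the square gives \<sigma> x f' = -(f - \<sigma>)^2/2 + (\<sigma>^2 + 2C)/2 +
  o(1) as x tends to 0. Were the constant term negative, the arctangent of a rescaled f - \<sigma>
  would have to vary at least like a multiple of ln x, which is unbounded near 0.\<close>

lemma riccati_discriminant_nonneg:
  fixes \<sigma> a b C :: real and f :: "real \<Rightarrow> real"
  assumes "\<sigma> > 0"
    and riccati: "\<And>x. x > 0 \<Longrightarrow> \<exists>f'. (f has_real_derivative f') (at x) \<and>
        \<sigma> * x * f' - \<sigma> * f x + (1/2) * (f x)\<^sup>2 = a * x\<^sup>2 + b * x + C"
  shows "\<sigma>\<^sup>2 + 2 * C \<ge> 0"
proof (rule ccontr)
  assume neg: "\<not> \<sigma>\<^sup>2 + 2 * C \<ge> 0"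
  \<comment> \<open>Then (\<sigma>^2 + 2C)/2 = -k^2. Half of it absorbs a x^2 + b x close to 0; the
    other half leaves k^2 + (f - \<sigma>)^2, the denominator in the derivative of arctan((f -
    \<sigma>)/k).\<close>
  define k where "k = sqrt (- (\<sigma>\<^sup>2 + 2 * C) / 2)"
  have k: "k > 0" "\<sigma>\<^sup>2 + 2 * C = - 2 * k\<^sup>2" using neg by (simp_all add: k_def)
  have "((\<lambda>x. a * x\<^sup>2 + b * x) \<longlongrightarrow> a * 0\<^sup>2 + b * 0) (at_right (0::real))"
    by (intro tendsto_intros)
  then have "eventually (\<lambda>x. a * x\<^sup>2 + b * x < k\<^sup>2 / 2) (at_right 0)"
    by (rule order_tendstoD) (use k in simp)
  then obtain d where d: "d > 0" "\<And>x. 0 < x \<Longrightarrow> x < d \<Longrightarrow> a * x\<^sup>2 + b * x < k\<^sup>2 / 2"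
    unfolding eventually_at_right[OF zero_less_one] by blast
  \<comment> \<open>decreasing near \<open>0\<close> with bounded arctangent part, which would bound \<open>ln\<close> below there\<close>
  define \<theta> where "\<theta> x = arctan ((f x - \<sigma>) / k) + k / (2 * \<sigma>) * ln x" for x
  have deriv: "\<exists>D. (\<theta> has_real_derivative D) (at x) \<and> D \<le> 0" if x: "0 < x" "x < d" for x
  proof -
    obtain f' where f': "(f has_real_derivative f') (at x)"
      and eq: "\<sigma> * x * f' - \<sigma> * f x + (1/2) * (f x)\<^sup>2 = a * x\<^sup>2 + b * x + C"
      using riccati[OF x(1)] by blast
    have pos: "k\<^sup>2 + (f x - \<sigma>)\<^sup>2 > 0" using k by (simp add: add_pos_nonneg)
    have "\<sigma> * x * f' = - (f x - \<sigma>)\<^sup>2 / 2 + (\<sigma>\<^sup>2 + 2 * C) / 2 + (a * x\<^sup>2 + b * x)"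
      using eq by (simp add: power2_eq_square field_simps)
    also have "\<dots> \<le> - (k\<^sup>2 + (f x - \<sigma>)\<^sup>2) / 2"
      using d(2)[OF x] k(2) by simp
    finally have "f' / (k\<^sup>2 + (f x - \<sigma>)\<^sup>2) \<le> - (1 / (2 * \<sigma> * x))"
      using pos x \<open>\<sigma> > 0\<close> by (simp add: field_simps)
    from mult_left_mono[OF this, of k]
    have le: "k * (f' / (k\<^sup>2 + (f x - \<sigma>)\<^sup>2)) + k / (2 * \<sigma>) * (1 / x) \<le> 0" using k(1) by simp
    have "(\<theta> has_real_derivative
        (f' / k) / (1 + ((f x - \<sigma>) / k)\<^sup>2) + k / (2 * \<sigma>) * (1 / x)) (at x)"
      unfolding \<theta>_def using k(1) x \<open>\<sigma> > 0\<close>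
      by (auto intro!: derivative_eq_intros f' simp: field_simps)
    moreover have "(f' / k) / (1 + ((f x - \<sigma>) / k)\<^sup>2) = k * (f' / (k\<^sup>2 + (f x - \<sigma>)\<^sup>2))"
    proof -
      have "1 + ((f x - \<sigma>) / k)\<^sup>2 = (k\<^sup>2 + (f x - \<sigma>)\<^sup>2) / k\<^sup>2"
        using k(1) by (simp add: power_divide field_simps)
      then show ?thesis using k(1) pos by (simp add: field_simps power2_eq_square)
    qed
    ultimately show ?thesis using le by auto
  qed
  \<comment> \<open>The endpoint d/2 is taken because the sign of the derivative is known only
    strictly below d.\<close>
  have lower: "\<theta> (d / 2) - pi / 2 \<le> k / (2 * \<sigma>) * ln x" if x: "0 < x" "x < d / 2" for x
  proof -
    have "\<theta> (d / 2) \<le> \<theta> x"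
    proof (rule DERIV_nonpos_imp_nonincreasing[of x "d / 2" \<theta>])
      fix z assume "x \<le> z" "z \<le> d / 2"
      then show "\<exists>D. (\<theta> has_real_derivative D) (at z) \<and> D \<le> 0"
        using x d(1) by (intro deriv) auto
    qed (use x in simp)
    then show ?thesis using arctan_ubound[of "(f x - \<sigma>) / k"] unfolding \<theta>_def by linarith
  qed
  have "filterlim (\<lambda>x. k / (2 * \<sigma>) * ln x) at_bot (at_right 0)"
    using k(1) \<open>\<sigma> > 0\<close> by (intro filterlim_tendsto_pos_mult_at_bot[OF tendsto_const] ln_at_0) simp
  then have "eventually (\<lambda>x. k / (2 * \<sigma>) * ln x < \<theta> (d / 2) - pi / 2) (at_right 0)"
    by (simp add: filterlim_at_bot_dense)
  moreover have "eventually (\<lambda>x. 0 < x \<and> x < d / 2) (at_right 0)"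
    using d(1) by (auto simp: eventually_at_right intro!: exI[of _ "d/2"])
  ultimately have "eventually (\<lambda>x. False) (at_right (0::real))"
    by eventually_elim (meson lower not_less)
  then show False by simp
qed

subsection \<open>The Bessel series\<close>

text \<open>For w > 0 this is w^(-\<nu>/2) I_\<nu>(2 sqrt w), a regularized 0F1. Splitting off the
  power leaves an everywhere convergent series that can be differentiated termwise.\<close>

definition bessel_series :: "real \<Rightarrow> real \<Rightarrow> real" where
  "bessel_series \<nu> w = (\<Sum>k. rGamma (real k + \<nu> + 1) / fact k * w ^ k)"

lemma rGamma_Suc_shift:
  fixes \<nu> :: real
  shows "(real k + \<nu> + 1) * rGamma (real (Suc k) + \<nu> + 1) = rGamma (real k + \<nu> + 1)"
  using rGamma_plus1[of "real k + \<nu> + 1"] by (simp add: algebra_simps)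

text \<open>Each step of the Gamma recurrence divides by a factor at least 1, as \<nu> is
  nonnegative. The resulting bound, uniform in k, lets the exponential series dominate the Bessel
  series.\<close>

lemma rGamma_shift_bounds:
  fixes \<nu> :: real
  assumes "\<nu> \<ge> 0"
  shows "0 < rGamma (real k + \<nu> + 1)" "rGamma (real (Suc k) + \<nu> + 1) \<le> rGamma (\<nu> + 1)"
proof -
  show pos: "0 < rGamma (real k + \<nu> + 1)" for k
    using assms by (simp add: rGamma_inverse_Gamma)
  show "rGamma (real (Suc k) + \<nu> + 1) \<le> rGamma (\<nu> + 1)"
  proof (induction k)
    case 0
    then show ?case
      using rGamma_Suc_shift[of 0 \<nu>] mult_right_mono[of 1 "\<nu> + 1" "rGamma (1 + \<nu> + 1)"]
        pos[of 1] assms by simp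
  next
    case (Suc k)
    have "1 * rGamma (real (Suc (Suc k)) + \<nu> + 1) \<le>
        (real (Suc k) + \<nu> + 1) * rGamma (real (Suc (Suc k)) + \<nu> + 1)"
      using assms pos[of "Suc (Suc k)"] by (intro mult_right_mono) auto
    then show ?case using Suc rGamma_Suc_shift[of "Suc k" \<nu>] by simp
  qed
qed

lemma summable_bessel_series:
  assumes "\<nu> \<ge> 0"
  shows "summable (\<lambda>k. rGamma (real k + \<nu> + 1) / fact k * w ^ k)"
proof (rule summable_comparison_test')
  show "summable (\<lambda>k. rGamma (\<nu> + 1) * (\<bar>w\<bar> ^ k /\<^sub>R fact k))"
    by (intro summable_mult summable_exp_generic)
  fix k :: nat
  have "rGamma (real k + \<nu> + 1) \<le> rGamma (\<nu> + 1)"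
    using rGamma_shift_bounds(2)[OF assms, of "k - 1"] by (cases k) auto
  then show "norm (rGamma (real k + \<nu> + 1) / fact k * w ^ k)
      \<le> rGamma (\<nu> + 1) * (\<bar>w\<bar> ^ k /\<^sub>R fact k)"
    using rGamma_shift_bounds(1)[OF assms, of k]
    by (simp add: abs_mult power_abs divide_simps mult_right_mono)
qed

lemma Suc_div_fact_Suc: "real (Suc k) * (c / fact (Suc k)) = c / fact k"
  by (simp del: of_nat_Suc)

text \<open>The factor k + 1 produced by differentiation cancels against the factorial, so only the
  argument of \<open>rGamma\<close> is shifted.\<close>

lemma DERIV_bessel_series:
  assumes "\<nu> \<ge> 0"
  shows "(bessel_series \<nu> has_real_derivative bessel_series (\<nu> + 1) w) (at w)"
proof -
  have "diffs (\<lambda>k. rGamma (real k + \<nu> + 1) / fact k) = (\<lambda>k. rGamma (real k + (\<nu> + 1) + 1) / fact k)"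
    by (auto simp: diffs_def fun_eq_iff Suc_div_fact_Suc add_ac simp del: of_nat_Suc fact_Suc)
      (simp add: add_ac)
  then show ?thesis
    using termdiffs_strong_converges_everywhere[OF summable_bessel_series[OF assms], of w]
    by (simp add: bessel_series_def[abs_def])
qed

text \<open>As differentiation raises the order by one, this is the equation w S'' + (\<nu> + 1) S'
  = S. On coefficients it reduces to \<open>rGamma_Suc_shift\<close>.\<close>

lemma bessel_series_ode:
  assumes "\<nu> \<ge> 0"
  shows "w * bessel_series (\<nu> + 2) w + (\<nu> + 1) * bessel_series (\<nu> + 1) w = bessel_series \<nu> w"
proof -
  let ?c = "\<lambda>\<nu> k. rGamma (real k + \<nu> + 1) / fact k :: real"
  have s: "(\<lambda>k. ?c \<nu> k * w ^ k) sums bessel_series \<nu> w" if "\<nu> \<ge> 0" for \<nu>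
    unfolding bessel_series_def using that by (intro summable_sums summable_bessel_series)
  have "(\<lambda>k. w * (?c (\<nu> + 2) k * w ^ k)) sums (w * bessel_series (\<nu> + 2) w)"
    using assms by (intro sums_mult s) auto
  moreover have "w * (?c (\<nu> + 2) k * w ^ k) = real (Suc k) * ?c (\<nu> + 1) (Suc k) * w ^ Suc k" for k
    by (subst Suc_div_fact_Suc) (simp add: add_ac)
  ultimately have "(\<lambda>k. real (Suc k) * ?c (\<nu> + 1) (Suc k) * w ^ Suc k) sums
      (w * bessel_series (\<nu> + 2) w)" by (simp only:)
  \<comment> \<open>The term added at k = 0 by the index shift vanishes through its factor
    k.\<close>
  then have "(\<lambda>k. real k * ?c (\<nu> + 1) k * w ^ k) sums (w * bessel_series (\<nu> + 2) w)"
    by (subst (asm) sums_Suc_iff) simp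
  from sums_add[OF this sums_mult[OF s[of "\<nu> + 1"], of "\<nu> + 1"]]
  have "(\<lambda>k. real k * ?c (\<nu> + 1) k * w ^ k + (\<nu> + 1) * (?c (\<nu> + 1) k * w ^ k)) sums
      (w * bessel_series (\<nu> + 2) w + (\<nu> + 1) * bessel_series (\<nu> + 1) w)"
    using assms by simp
  moreover have "real k * ?c (\<nu> + 1) k * w ^ k + (\<nu> + 1) * (?c (\<nu> + 1) k * w ^ k) = ?c \<nu> k * w ^ k" for k
  proof -
    have "real k * ?c (\<nu> + 1) k * w ^ k + (\<nu> + 1) * (?c (\<nu> + 1) k * w ^ k)
        = ((real k + \<nu> + 1) * rGamma (real (Suc k) + \<nu> + 1)) / fact k * w ^ k"
      by (simp add: field_simps)
    then show ?thesis by (simp only: rGamma_Suc_shift)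
  qed
  ultimately show ?thesis using s[OF assms] sums_unique2 by simp
qed

section \<open>The profile of the kernel and its second-order equation\<close>

text \<open>For w > 0 this is sqrt w * I_\<nu>(2 sqrt w). The extra square root accounts for the
  prefactor sqrt(Axy) of the kernel and removes the first-order term from the differential
  equation.\<close>

definition bessel_G :: "real \<Rightarrow> real \<Rightarrow> real" where
  "bessel_G \<nu> w = w powr ((1 + \<nu>) / 2) * bessel_series \<nu> w"

definition bessel_G' :: "real \<Rightarrow> real \<Rightarrow> real" where
  "bessel_G' \<nu> w = w powr ((1 + \<nu>) / 2) *
     (bessel_series (\<nu> + 1) w + (1 + \<nu>) / 2 * bessel_series \<nu> w / w)"

lemma DERIV_powr_div:
  fixes w :: real
  assumes "w > 0"
  shows "((\<lambda>w. w powr a) has_real_derivative a * (w powr a / w)) (at w)"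
  using has_real_derivative_powr[OF assms, of a] assms by (simp only: powr_diff) simp

lemma DERIV_bessel_G:
  assumes "\<nu> \<ge> 0" "w > 0"
  shows "(bessel_G \<nu> has_real_derivative bessel_G' \<nu> w) (at w)"
proof -
  have "(bessel_G \<nu> has_real_derivative
      (1 + \<nu>) / 2 * (w powr ((1 + \<nu>) / 2) / w) * bessel_series \<nu> w
      + bessel_series (\<nu> + 1) w * w powr ((1 + \<nu>) / 2)) (at w)"
    unfolding bessel_G_def using assms
    by (intro DERIV_mult DERIV_bessel_series DERIV_powr_div) auto
  also have "(1 + \<nu>) / 2 * (w powr ((1 + \<nu>) / 2) / w) * bessel_series \<nu> w
      + bessel_series (\<nu> + 1) w * w powr ((1 + \<nu>) / 2) = bessel_G' \<nu> w"
    by (simp add: bessel_G'_def algebra_simps)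
  finally show ?thesis .
qed

text \<open>With a = (1 + \<nu>)/2 the product rule produces w S'' + 2a S'. Since 2a = \<nu> + 1,
  \<open>bessel_series_ode\<close> collapses this to S, and the remaining coefficient is a(a - 1) =
  (\<nu>^2 - 1)/4.\<close>

lemma DERIV_bessel_G':
  assumes "\<nu> \<ge> 0" "w > 0"
  shows "(bessel_G' \<nu> has_real_derivative bessel_G \<nu> w * (1 / w + (\<nu>\<^sup>2 - 1) / 4 / w\<^sup>2)) (at w)"
proof -
  define a where "a = (1 + \<nu>) / 2"
  define P where "P = w powr a"
  let ?g = "\<lambda>k. bessel_series (\<nu> + k) w"
  have \<nu>: "\<nu> = 2 * a - 1" by (simp add: a_def field_simps)
  have "((\<lambda>w. a * bessel_series \<nu> w) has_real_derivative a * ?g 1) (at w)"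
    by (intro DERIV_cmult DERIV_bessel_series assms)
  from DERIV_divide[OF this DERIV_ident]
  have "((\<lambda>w. bessel_series (\<nu> + 1) w + a * bessel_series \<nu> w / w) has_real_derivative
      ?g 2 + (a * ?g 1 * w - a * ?g 0 * 1) / (w * w)) (at w)"
    using assms DERIV_bessel_series[of "\<nu> + 1" w]
    by (intro DERIV_add) (simp_all add: add.assoc)
  from DERIV_mult[OF DERIV_powr_div[OF assms(2), of a] this]
  have "(bessel_G' \<nu> has_real_derivative
      (a * (P / w)) * (?g 1 + a * ?g 0 / w)
      + (?g 2 + (a * ?g 1 * w - a * ?g 0 * 1) / (w * w)) * P) (at w)"
    by (simp only: bessel_G'_def[abs_def] add_0_right a_def P_def)
  also have "(a * (P / w)) * (?g 1 + a * ?g 0 / w)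
      + (?g 2 + (a * ?g 1 * w - a * ?g 0 * 1) / (w * w)) * P
    = P * ((w * ?g 2 + (\<nu> + 1) * ?g 1) / w + a * (a - 1) * ?g 0 / w\<^sup>2)"
    using assms(2) unfolding power2_eq_square by (simp add: \<nu>) (simp add: field_simps)
  also have "w * ?g 2 + (\<nu> + 1) * ?g 1 = bessel_series \<nu> w"
    by (rule bessel_series_ode[OF assms(1)])
  also have "P * (bessel_series \<nu> w / w + a * (a - 1) * ?g 0 / w\<^sup>2)
      = P * bessel_series \<nu> w * (1 / w + a * (a - 1) / w\<^sup>2)"
    by (simp add: algebra_simps)
  also have "a * (a - 1) = (\<nu>\<^sup>2 - 1) / 4" by (simp add: a_def power2_eq_square field_simps)
  also have "P * bessel_series \<nu> w = bessel_G \<nu> w" by (simp add: bessel_G_def P_def a_def)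
  finally show ?thesis .
qed

subsection \<open>Poisson mixtures of Gamma densities\<close>

text \<open>Substitution t = p y in Euler's integral. Working with the nonnegative integral makes
  the later termwise integration a case of Tonelli's theorem.\<close>

lemma nn_integral_Gamma_rate:
  fixes s p :: real
  assumes "s > 0" "p > 0"
  shows "(\<integral>\<^sup>+y. ennreal (indicator {0..} y * y powr (s - 1) * exp (- p * y)) \<partial>lborel)
    = ennreal (Gamma s / p powr s)"
proof -
  let ?h = "\<lambda>t::real. indicator {0..} t * t powr (s - 1) / exp t"
  let ?e = "\<lambda>y::real. indicator {0..} y * y powr (s - 1) * exp (- p * y)"
  have "?h (0 + p * y) = p powr (s - 1) * (indicator {0..} y * y powr (s - 1) * exp (- p * y))" for y
    using assms by (auto simp: powr_mult exp_minus field_simps zero_le_mult_iff split: split_indicator)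
  then have "ennreal (Gamma s) = ennreal p * (\<integral>\<^sup>+y. ennreal (p powr (s - 1) * ?e y) \<partial>lborel)"
    using assms nn_integral_real_affine[of "\<lambda>t. ennreal (?h t)" p 0]
    by (simp add: Gamma_conv_nn_integral_real)
  also have "(\<integral>\<^sup>+y. ennreal (p powr (s - 1) * ?e y) \<partial>lborel) = ennreal (p powr (s - 1)) * (\<integral>\<^sup>+y. ennreal (?e y) \<partial>lborel)"
    by (subst nn_integral_cmult[symmetric]) (simp_all add: ennreal_mult')
  also have "ennreal p * \<dots> = ennreal (p * p powr (s - 1)) * (\<integral>\<^sup>+y. ennreal (?e y) \<partial>lborel)"
    using assms by (simp add: ennreal_mult' mult.assoc)
  also have "p * p powr (s - 1) = p powr s"
    using assms by (simp add: powr_mult_base)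
  finally have eq: "ennreal (p powr s) *
      (\<integral>\<^sup>+y. ennreal (indicator {0..} y * y powr (s - 1) * exp (- p * y)) \<partial>lborel) = ennreal (Gamma s)"
    by simp
  show ?thesis
    using assms by (simp add: divide_ennreal[symmetric] eq[symmetric] ennreal_times_divide
        mult_divide_eq_ennreal mult.commute[of "ennreal (p powr s)"] Gamma_real_nonneg)
qed

text \<open>
  Up to normalization this is a Poisson mixture of Gamma densities (a noncentral chi-squared law),
  so its moments are explicit.
\<close>

definition mixture_density :: "real \<Rightarrow> real \<Rightarrow> real \<Rightarrow> real \<Rightarrow> real" where
  "mixture_density \<nu> q p y = indicator {0..} y * y powr \<nu> * bessel_series \<nu> (q * y) * exp (- p * y)"

lemma bessel_series_nonneg:
  assumes "\<nu> \<ge> 0" "w \<ge> 0"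
  shows "bessel_series \<nu> w \<ge> 0"
  unfolding bessel_series_def using assms less_imp_le[OF rGamma_shift_bounds(1)[OF assms(1)]]
  by (intro suminf_nonneg summable_bessel_series) auto

lemma mixture_density_nonneg:
  assumes "\<nu> \<ge> 0" "q \<ge> 0"
  shows "mixture_density \<nu> q p y \<ge> 0"
  using assms by (auto simp: mixture_density_def bessel_series_nonneg split: split_indicator)

lemma measurable_bessel_series [measurable]:
  assumes "\<nu> \<ge> 0"
  shows "bessel_series \<nu> \<in> borel_measurable borel"
  using DERIV_bessel_series[OF assms]
  by (intro borel_measurable_continuous_onI continuous_at_imp_continuous_on) (auto intro: DERIV_isCont)

lemma measurable_mixture_density:
  assumes "\<nu> \<ge> 0"
  shows "mixture_density \<nu> q p \<in> borel_measurable borel"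
proof -
  note measurable_bessel_series[OF assms, measurable]
  show ?thesis unfolding mixture_density_def[abs_def] by measurable
qed

text \<open>Integrating the Bessel series termwise gives Gamma integrals of shape k + \<nu> + 1 + m.
  The quotient of Gamma values left in \<open>sums\<close> is a polynomial of degree m in k, so S is
  a polynomial moment of the exponential series.\<close>

lemma mixture_density_moment:
  assumes "\<nu> \<ge> 0" "q \<ge> 0" "p > 0" "S \<ge> 0"
    and sums: "(\<lambda>k. (rGamma (real k + \<nu> + 1) * Gamma (real k + \<nu> + 1 + real m)) * ((q / p) ^ k / fact k)) sums S"
  shows "has_bochner_integral lborel (\<lambda>y. y ^ m * mixture_density \<nu> q p y) (S / p powr (\<nu> + 1 + real m))"
proof (rule has_bochner_integral_nn_integral)
  note measurable_mixture_density[OF assms(1), measurable]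
  show "(\<lambda>y. y ^ m * mixture_density \<nu> q p y) \<in> borel_measurable lborel" by measurable
  show "AE y in lborel. 0 \<le> y ^ m * mixture_density \<nu> q p y"
    using assms by (intro AE_I2) (simp add: mixture_density_def bessel_series_nonneg split: split_indicator)
  show "0 \<le> S / p powr (\<nu> + 1 + real m)" using assms by simp
  let ?c = "\<lambda>k. rGamma (real k + \<nu> + 1) / fact k * q ^ k"
  let ?s = "\<lambda>k. real k + \<nu> + 1 + real m"
  let ?d = "\<lambda>k y. indicator {0..} y * y powr (?s k - 1) * exp (- p * y) :: real"
  have c: "?c k \<ge> 0" for k using assms rGamma_shift_bounds(1)[OF assms(1), of k] by simp
  \<comment> \<open>Leaving out the null set y = 0 separates y > 0, where the power laws apply, from
    y < 0, where both sides vanish.\<close>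
  have "ennreal (y ^ m * mixture_density \<nu> q p y) = (\<Sum>k. ennreal (?c k) * ennreal (?d k y))" if "y \<noteq> 0" for y
  proof (cases "y > 0")
    case True
    have "(\<lambda>k. rGamma (real k + \<nu> + 1) / fact k * (q * y) ^ k) sums bessel_series \<nu> (q * y)"
      unfolding bessel_series_def by (intro summable_sums summable_bessel_series assms)
    from sums_mult[OF this, of "y powr \<nu> * y ^ m * exp (- p * y)"]
    have "(\<lambda>k. ?c k * ?d k y) sums (y ^ m * mixture_density \<nu> q p y)"
      using True by (simp add: mixture_density_def powr_add powr_realpow power_mult_distrib mult_ac)
    moreover have "0 \<le> ?c k * ?d k y" for k by (intro mult_nonneg_nonneg c) auto
    ultimately have "(\<Sum>k. ennreal (?c k * ?d k y)) = ennreal (y ^ m * mixture_density \<nu> q p y)"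
      by (intro suminf_ennreal_eq)
    then show ?thesis by (simp only: ennreal_mult'[OF c])
  qed (use that in \<open>simp add: mixture_density_def\<close>)
  then have "(\<integral>\<^sup>+y. ennreal (y ^ m * mixture_density \<nu> q p y) \<partial>lborel)
      = (\<integral>\<^sup>+y. (\<Sum>k. ennreal (?c k) * ennreal (?d k y)) \<partial>lborel)"
    using AE_lborel_singleton[of "0::real"] by (intro nn_integral_cong_AE) (auto elim: eventually_mono)
  also have "\<dots> = (\<Sum>k. ennreal (?c k) * (\<integral>\<^sup>+y. ennreal (?d k y) \<partial>lborel))"
    by (subst nn_integral_suminf) (auto simp: nn_integral_cmult)
  also have "\<dots> = (\<Sum>k. ennreal (?c k * (Gamma (?s k) / p powr ?s k)))"
  proof -
    have "(\<integral>\<^sup>+y. ennreal (?d k y) \<partial>lborel) = ennreal (Gamma (?s k) / p powr ?s k)" for k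
      using assms(1,3) by (intro nn_integral_Gamma_rate) auto
    then show ?thesis by (simp only: ennreal_mult'[OF c])
  qed
  also have "\<dots> = (\<Sum>k. ennreal ((rGamma (real k + \<nu> + 1) * Gamma (?s k)) * ((q / p) ^ k / fact k) / p powr (\<nu> + 1 + real m)))"
  proof (intro suminf_cong arg_cong[of _ _ ennreal])
    fix k
    have "p powr ?s k = p ^ k * p powr (\<nu> + 1 + real m)"
      using assms(3) powr_add[of p "real k" "\<nu> + 1 + real m"] by (simp add: powr_realpow add_ac)
    then show "?c k * (Gamma (?s k) / p powr ?s k)
        = (rGamma (real k + \<nu> + 1) * Gamma (?s k)) * ((q / p) ^ k / fact k) / p powr (\<nu> + 1 + real m)"
      by (simp add: power_divide mult_ac)
  qed
  also have "\<dots> = ennreal (S / p powr (\<nu> + 1 + real m))"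
    using assms rGamma_shift_bounds(1)[OF assms(1)]
    by (intro suminf_ennreal_eq sums_divide sums) (auto intro!: divide_nonneg_nonneg mult_nonneg_nonneg less_imp_le[OF rGamma_shift_bounds(1)] Gamma_real_nonneg)
  finally show "(\<integral>\<^sup>+y. ennreal (y ^ m * mixture_density \<nu> q p y) \<partial>lborel)
      = ennreal (S / p powr (\<nu> + 1 + real m))" .
qed

text \<open>These are unnormalized factorial moments of the Poisson law. The truncated
  \<open>k - 1\<close> is harmless at k = 0 because of the factor k.\<close>

lemma exp_weighted_sums:
  fixes z :: real
  shows "(\<lambda>k. z ^ k / fact k) sums exp z"
    and "(\<lambda>k. real k * (z ^ k / fact k)) sums (z * exp z)"
    and "(\<lambda>k. real k * real (k - 1) * (z ^ k / fact k)) sums (z\<^sup>2 * exp z)"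
proof -
  show s0: "(\<lambda>k. z ^ k / fact k) sums exp z"
    using exp_converges[of z] by (simp add: field_simps)
  have "real (Suc k) * (z ^ Suc k / fact (Suc k)) = z * (z ^ k / fact k)" for k
    by (subst Suc_div_fact_Suc) simp
  then show s1: "(\<lambda>k. real k * (z ^ k / fact k)) sums (z * exp z)"
    using sums_mult[OF s0, of z] sums_Suc_iff[of "\<lambda>k. real k * (z ^ k / fact k)" "z * exp z"]
    by (simp only: of_nat_0 mult_zero_left add_0_right)
  have "real (Suc k) * real (Suc k - 1) * (z ^ Suc k / fact (Suc k)) = z * (real k * (z ^ k / fact k))" for k
  proof -
    have "real (Suc k) * real (Suc k - 1) * (z ^ Suc k / fact (Suc k))
        = real k * (real (Suc k) * (z ^ Suc k / fact (Suc k)))" by simp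
    then show ?thesis by (subst (asm) Suc_div_fact_Suc) simp
  qed
  then show "(\<lambda>k. real k * real (k - 1) * (z ^ k / fact k)) sums (z\<^sup>2 * exp z)"
    using sums_mult[OF s1, of z]
      sums_Suc_iff[of "\<lambda>k. real k * real (k - 1) * (z ^ k / fact k)" "z\<^sup>2 * exp z"]
    by (simp only: of_nat_0 mult_zero_left add_0_right power2_eq_square mult.assoc)
qed

text \<open>Given a Poisson count k of mean l, the law is Gamma with shape k + \<nu> + 1 and rate p,
  with first two moments (k + \<nu> + 1)/p and (k + \<nu> + 1)(k + \<nu> + 2)/p^2. These are
  averaged over k; M is the total mass.\<close>

lemma mixture_density_moments:
  fixes \<nu> q p :: real
  assumes "\<nu> \<ge> 0" "q \<ge> 0" "p > 0"
  defines "l \<equiv> q / p"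
  defines "M \<equiv> exp l / p powr (\<nu> + 1)"
  shows "has_bochner_integral lborel (mixture_density \<nu> q p) M"
    and "has_bochner_integral lborel (\<lambda>y. y * mixture_density \<nu> q p y) (M * ((l + \<nu> + 1) / p))"
    and "has_bochner_integral lborel (\<lambda>y. y\<^sup>2 * mixture_density \<nu> q p y)
      (M * ((l\<^sup>2 + (2 * \<nu> + 4) * l + (\<nu> + 1) * (\<nu> + 2)) / p\<^sup>2))"
proof -
  have l: "l \<ge> 0" using assms by simp
  have pos: "rGamma (real k + \<nu> + 1) \<noteq> 0" "Gamma (real k + \<nu> + 1) \<noteq> 0" for k
    using rGamma_shift_bounds(1)[OF assms(1), of k]
    by (metis less_irrefl, metis less_irrefl rGamma_inverse_Gamma inverse_zero)
  have r0: "rGamma (real k + \<nu> + 1) * Gamma (real k + \<nu> + 1 + real 0) = 1" for k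
    using pos[of k] by (simp add: rGamma_inverse_Gamma)
  have G1: "Gamma (real k + \<nu> + 1 + real 1) = (real k + \<nu> + 1) * Gamma (real k + \<nu> + 1)" for k
    using assms Gamma_plus1[of "real k + \<nu> + 1"] by (simp add: add_nonneg_pos nonpos_Ints_def)
  have r1: "rGamma (real k + \<nu> + 1) * Gamma (real k + \<nu> + 1 + real 1) = real k + \<nu> + 1" for k
    using r0[of k] by (simp only: G1) (simp add: mult_ac)
  have G2: "Gamma (real k + \<nu> + 1 + real 2) = (real k + \<nu> + 2) * Gamma (real k + \<nu> + 1 + real 1)" for k
    using assms Gamma_plus1[of "real k + \<nu> + 2"] by (simp add: add_nonneg_pos nonpos_Ints_def add_ac)
  have r2: "rGamma (real k + \<nu> + 1) * Gamma (real k + \<nu> + 1 + real 2)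
      = (real k + \<nu> + 1) * (real k + \<nu> + 2)" for k
    using r1[of k] by (simp only: G2) (simp add: mult_ac)
  have "(\<lambda>k. 1 * (l ^ k / fact k)) sums exp l"
    using exp_weighted_sums(1) by simp
  from mixture_density_moment[of \<nu> q p _ 0, unfolded r0, folded l_def, OF assms(1-3) _ this]
  show "has_bochner_integral lborel (mixture_density \<nu> q p) M"
    by (simp add: M_def)
  have "(\<lambda>k. (real k + \<nu> + 1) * (l ^ k / fact k)) sums (l * exp l + (\<nu> + 1) * exp l)"
    using sums_add[OF exp_weighted_sums(2)[of l] sums_mult[OF exp_weighted_sums(1)[of l], of "\<nu> + 1"]]
    by (simp add: algebra_simps add_divide_distrib)
  from mixture_density_moment[of \<nu> q p _ 1, unfolded r1, folded l_def, OF assms(1-3) _ this]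
  have "has_bochner_integral lborel (\<lambda>y. y * mixture_density \<nu> q p y)
      ((l * exp l + (\<nu> + 1) * exp l) / p powr (\<nu> + 1 + real 1))"
    using l assms(1) by simp
  also have "(l * exp l + (\<nu> + 1) * exp l) / p powr (\<nu> + 1 + real 1) = M * ((l + \<nu> + 1) / p)"
    unfolding M_def powr_add[of p "\<nu> + 1" "real 1"] powr_realpow[OF assms(3)]
    by (simp add: algebra_simps add_divide_distrib)
  finally show "has_bochner_integral lborel (\<lambda>y. y * mixture_density \<nu> q p y) (M * ((l + \<nu> + 1) / p))" .
  have "real k * real (k - 1) = real k * (real k - 1)" for k by (cases k) auto
  note s2 = exp_weighted_sums(3)[of l, unfolded this]
  \<comment> \<open>In factorial powers the weight is k(k - 1) + (2\<nu> + 4)k + (\<nu> + 1)(\<nu> +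
    2).\<close>
  have "(\<lambda>k. (real k + \<nu> + 1) * (real k + \<nu> + 2) * (l ^ k / fact k)) sums
      (l\<^sup>2 * exp l + (2 * \<nu> + 4) * (l * exp l) + (\<nu> + 1) * (\<nu> + 2) * exp l)"
    using sums_add[OF sums_add[OF s2 sums_mult[OF exp_weighted_sums(2)[of l], of "2 * \<nu> + 4"]]
        sums_mult[OF exp_weighted_sums(1)[of l], of "(\<nu> + 1) * (\<nu> + 2)"]]
    by (simp add: algebra_simps add_divide_distrib diff_divide_distrib)
  from mixture_density_moment[of \<nu> q p _ 2, unfolded r2, folded l_def, OF assms(1-3) _ this]
  have "has_bochner_integral lborel (\<lambda>y. y\<^sup>2 * mixture_density \<nu> q p y)
      ((l\<^sup>2 * exp l + (2 * \<nu> + 4) * (l * exp l) + (\<nu> + 1) * (\<nu> + 2) * exp l) / p powr (\<nu> + 1 + real 2))"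
    using l assms(1) by simp
  also have "(l\<^sup>2 * exp l + (2 * \<nu> + 4) * (l * exp l) + (\<nu> + 1) * (\<nu> + 2) * exp l) / p powr (\<nu> + 1 + real 2)
      = M * ((l\<^sup>2 + (2 * \<nu> + 4) * l + (\<nu> + 1) * (\<nu> + 2)) / p\<^sup>2)"
    unfolding M_def powr_add[of p "\<nu> + 1" "real 2"] powr_realpow[OF assms(3)]
    by (simp add: algebra_simps add_divide_distrib)
  finally show "has_bochner_integral lborel (\<lambda>y. y\<^sup>2 * mixture_density \<nu> q p y)
      (M * ((l\<^sup>2 + (2 * \<nu> + 4) * l + (\<nu> + 1) * (\<nu> + 2)) / p\<^sup>2))" .
qed

section \<open>Concentration from second moments\<close>

text \<open>A Chebyshev argument: if the mass tends to 1 and the second moment about a tends to 0,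
  the part of the mass away from a is negligible against a bounded function.\<close>

lemma concentrating_densities_tendsto:
  fixes k :: "'i \<Rightarrow> real \<Rightarrow> real" and \<psi> :: "real \<Rightarrow> real"
  assumes [measurable]: "\<psi> \<in> borel_measurable borel"
    and bounded: "\<And>y. \<bar>\<psi> y\<bar> \<le> K" and cont: "isCont \<psi> a"
    and nonneg: "eventually (\<lambda>i. \<forall>y. k i y \<ge> 0) F"
    and mass: "eventually (\<lambda>i. has_bochner_integral lborel (k i) (M i)) F" "(M \<longlongrightarrow> 1) F"
    and var: "eventually (\<lambda>i. has_bochner_integral lborel (\<lambda>y. (y - a)\<^sup>2 * k i y) (V i)) F" "(V \<longlongrightarrow> 0) F"
  shows "((\<lambda>i. LINT y|lborel. \<psi> y * k i y) \<longlongrightarrow> \<psi> a) F"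
proof -
  have "((\<lambda>i. (LINT y|lborel. \<psi> y * k i y) - \<psi> a * M i) \<longlongrightarrow> 0) F"
  proof (rule tendstoI)
    fix e :: real assume "e > 0"
    then obtain d where d: "d > 0" "\<And>y. \<bar>y - a\<bar> < d \<Longrightarrow> \<bar>\<psi> y - \<psi> a\<bar> < e / 2"
      using cont[unfolded continuous_at_eps_delta dist_real_def] half_gt_zero by blast
    have K: "K \<ge> 0" using bounded[of 0] by linarith
    \<comment> \<open>Within distance d continuity gives e/2; beyond it the difference is at most
      2K, while (y - a)^2/d^2 is at least 1. A bound quadratic in y - a integrates to a combination
      of M and V.\<close>
    have bound: "\<bar>\<psi> y - \<psi> a\<bar> \<le> e / 2 + 2 * K / d\<^sup>2 * (y - a)\<^sup>2" for y
    proof (cases "\<bar>y - a\<bar> < d")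
      case True
      then show ?thesis using d(2)[OF True] K by (simp add: add_increasing2)
    next
      case False
      then have "(y - a)\<^sup>2 \<ge> d\<^sup>2" using d(1) by (metis abs_le_square_iff abs_of_pos not_less)
      then have "2 * K * d\<^sup>2 \<le> 2 * K * (y - a)\<^sup>2" using K by (intro mult_left_mono) auto
      then have "2 * K \<le> 2 * K / d\<^sup>2 * (y - a)\<^sup>2" using d(1) by (simp add: field_simps)
      then show ?thesis using bounded[of y] bounded[of a] \<open>e > 0\<close> by linarith
    qed
    have "((\<lambda>i. e / 2 * M i + 2 * K / d\<^sup>2 * V i) \<longlongrightarrow> e / 2 * 1 + 2 * K / d\<^sup>2 * 0) F"
      by (intro tendsto_intros mass var)
    then have "eventually (\<lambda>i. e / 2 * M i + 2 * K / d\<^sup>2 * V i < e) F"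
      by (rule order_tendstoD) (use \<open>e > 0\<close> in simp)
    with nonneg mass(1) var(1)
    show "eventually (\<lambda>i. dist ((LINT y|lborel. \<psi> y * k i y) - \<psi> a * M i) 0 < e) F"
    proof eventually_elim
      case (elim i)
      note m = elim(2) and v = elim(3)
      have [measurable]: "k i \<in> borel_measurable borel" using m by (auto simp: has_bochner_integral_iff dest: borel_measurable_integrable)
      have int: "integrable lborel (\<lambda>y. \<psi> y * k i y)"
        by (rule Bochner_Integration.integrable_bound[of _ "\<lambda>y. K * k i y"])
          (use m K elim(1) bounded in \<open>auto simp: has_bochner_integral_iff abs_mult intro!: mult_right_mono\<close>)
      have "(LINT y|lborel. \<psi> y * k i y) - \<psi> a * M i = (LINT y|lborel. (\<psi> y - \<psi> a) * k i y)"
        using int m by (simp add: has_bochner_integral_iff left_diff_distrib)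
      also have "\<bar>\<dots>\<bar> \<le> (LINT y|lborel. \<bar>(\<psi> y - \<psi> a) * k i y\<bar>)"
        by (rule integral_abs_bound)
      also have "\<dots> \<le> (LINT y|lborel. e / 2 * k i y + 2 * K / d\<^sup>2 * ((y - a)\<^sup>2 * k i y))"
      proof (rule integral_mono)
        show "integrable lborel (\<lambda>y. \<bar>(\<psi> y - \<psi> a) * k i y\<bar>)"
          using int m by (simp add: has_bochner_integral_iff left_diff_distrib)
        show "integrable lborel (\<lambda>y. e / 2 * k i y + 2 * K / d\<^sup>2 * ((y - a)\<^sup>2 * k i y))"
          using m v by (simp add: has_bochner_integral_iff)
        fix y
        have "\<bar>(\<psi> y - \<psi> a) * k i y\<bar> \<le> (e / 2 + 2 * K / d\<^sup>2 * (y - a)\<^sup>2) * k i y"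
          using elim(1) mult_right_mono[OF bound[of y], of "k i y"] by (simp add: abs_mult)
        then show "\<bar>(\<psi> y - \<psi> a) * k i y\<bar> \<le> e / 2 * k i y + 2 * K / d\<^sup>2 * ((y - a)\<^sup>2 * k i y)"
          by (simp add: algebra_simps)
      qed
      also have "\<dots> = e / 2 * M i + 2 * K / d\<^sup>2 * V i"
        using m v by (simp add: has_bochner_integral_iff)
      finally show ?case using elim(4) by simp
    qed
  qed
  from tendsto_add[OF this tendsto_mult[OF tendsto_const[of "\<psi> a"] mass(2)]]
  show ?thesis by simp
qed

subsection \<open>The driftless kernel\<close>

text \<open>
  In the application \<open>\<beta> t = \<surd>A coth (\<surd>A t / 2) / (2 \<sigma>)\<close> and \<open>m t = A / (4 \<sigma>\<^sup>2 sinh\<^sup>2 (\<surd>A t / 2))\<close>, but only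
  the following relations between them matter.
\<close>

locale bessel_kernel =
  fixes \<sigma> A B \<nu> :: real and \<beta> m :: "real \<Rightarrow> real"
  assumes \<sigma>_pos: "\<sigma> > 0" and \<nu>_nonneg: "\<nu> \<ge> 0"
    and m_pos: "t > 0 \<Longrightarrow> m t > 0"
    and \<beta>_sq: "t > 0 \<Longrightarrow> (\<beta> t)\<^sup>2 = m t + A / (4 * \<sigma>\<^sup>2)"
    and DERIV_\<beta>: "t > 0 \<Longrightarrow> (\<beta> has_real_derivative - \<sigma> * m t) (at t)"
    and DERIV_m: "t > 0 \<Longrightarrow> (m has_real_derivative - 2 * \<sigma> * \<beta> t * m t) (at t)"
begin

definition E :: "real \<Rightarrow> real \<Rightarrow> real \<Rightarrow> real" where
  "E t x y = exp (- B * t / (2 * \<sigma>) - \<beta> t * (x + y))"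

definition W :: "real \<Rightarrow> real \<Rightarrow> real \<Rightarrow> real" where
  "W t x y = m t * x * y"

definition Q :: "real \<Rightarrow> real \<Rightarrow> real \<Rightarrow> real" where
  "Q t x y = E t x y * bessel_G \<nu> (W t x y)"

definition Qx :: "real \<Rightarrow> real \<Rightarrow> real \<Rightarrow> real" where
  "Qx t x y = E t x y * (m t * y * bessel_G' \<nu> (W t x y) - \<beta> t * bessel_G \<nu> (W t x y))"

text \<open>The second derivative of \<open>bessel_G\<close> has been eliminated through its
  differential equation, so only \<open>bessel_G\<close> and \<open>bessel_G'\<close> occur.\<close>

definition Qxx :: "real \<Rightarrow> real \<Rightarrow> real \<Rightarrow> real" where
  "Qxx t x y = E t x y * (((\<beta> t)\<^sup>2 + m t * y / x + (\<nu>\<^sup>2 - 1) / 4 / x\<^sup>2) * bessel_G \<nu> (W t x y)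
     - 2 * \<beta> t * m t * y * bessel_G' \<nu> (W t x y))"

definition Qt :: "real \<Rightarrow> real \<Rightarrow> real \<Rightarrow> real" where
  "Qt t x y = E t x y * ((\<sigma> * m t * (x + y) - B / (2 * \<sigma>)) * bessel_G \<nu> (W t x y)
     - 2 * \<sigma> * \<beta> t * m t * x * y * bessel_G' \<nu> (W t x y))"

lemma W_pos: "t > 0 \<Longrightarrow> x > 0 \<Longrightarrow> y > 0 \<Longrightarrow> W t x y > 0"
  by (simp add: W_def m_pos)

lemma DERIV_Q_x:
  assumes "t > 0" "x > 0" "y > 0"
  shows "((\<lambda>x. Q t x y) has_real_derivative Qx t x y) (at x)"
proof -
  have W: "((\<lambda>x. W t x y) has_real_derivative m t * y) (at x)"
    unfolding W_def by (auto intro!: derivative_eq_intros)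
  have "((\<lambda>x. E t x y) has_real_derivative - \<beta> t * E t x y) (at x)"
    unfolding E_def by (auto intro!: derivative_eq_intros)
  from DERIV_mult[OF this DERIV_chain2[OF DERIV_bessel_G[OF \<nu>_nonneg W_pos[OF assms]] W]]
  show ?thesis by (simp add: Q_def Qx_def algebra_simps)
qed

lemma DERIV_Qx_x:
  assumes "t > 0" "x > 0" "y > 0"
  shows "((\<lambda>x. Qx t x y) has_real_derivative Qxx t x y) (at x)"
proof -
  let ?G = "bessel_G \<nu> (W t x y)" and ?G' = "bessel_G' \<nu> (W t x y)"
  have W: "((\<lambda>x. W t x y) has_real_derivative m t * y) (at x)"
    unfolding W_def by (auto intro!: derivative_eq_intros)
  have E: "((\<lambda>x. E t x y) has_real_derivative - \<beta> t * E t x y) (at x)"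
    unfolding E_def by (auto intro!: derivative_eq_intros)
  have "((\<lambda>x. m t * y * bessel_G' \<nu> (W t x y) - \<beta> t * bessel_G \<nu> (W t x y)) has_real_derivative
      m t * y * (?G * (1 / W t x y + (\<nu>\<^sup>2 - 1) / 4 / (W t x y)\<^sup>2) * (m t * y)) - \<beta> t * (?G' * (m t * y))) (at x)"
    by (intro DERIV_diff DERIV_cmult
        DERIV_chain2[OF DERIV_bessel_G[OF \<nu>_nonneg W_pos[OF assms]] W]
        DERIV_chain2[OF DERIV_bessel_G'[OF \<nu>_nonneg W_pos[OF assms]] W])
  also have "m t * y * (?G * (1 / W t x y + (\<nu>\<^sup>2 - 1) / 4 / (W t x y)\<^sup>2) * (m t * y))
      = ?G * ((m t * y)\<^sup>2 / W t x y + (\<nu>\<^sup>2 - 1) / 4 * ((m t * y)\<^sup>2 / (W t x y)\<^sup>2))"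
    by (simp add: algebra_simps power2_eq_square add_divide_distrib diff_divide_distrib)
  also have "(m t * y)\<^sup>2 / W t x y = m t * y / x"
    using assms m_pos[OF assms(1)] by (simp add: W_def power2_eq_square)
  also have "(m t * y)\<^sup>2 / (W t x y)\<^sup>2 = 1 / x\<^sup>2"
    using assms m_pos[OF assms(1)] by (simp add: W_def power2_eq_square)
  finally have "((\<lambda>x. m t * y * bessel_G' \<nu> (W t x y) - \<beta> t * bessel_G \<nu> (W t x y)) has_real_derivative
      ?G * (m t * y / x + (\<nu>\<^sup>2 - 1) / 4 * (1 / x\<^sup>2)) - \<beta> t * (?G' * (m t * y))) (at x)" .
  from DERIV_mult[OF E this]
  show ?thesis by (simp add: Qx_def Qxx_def algebra_simps power2_eq_square)
qed

lemma DERIV_Q_t: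
  assumes "t > 0" "x > 0" "y > 0"
  shows "((\<lambda>t. Q t x y) has_real_derivative Qt t x y) (at t)"
proof -
  have W: "((\<lambda>t. W t x y) has_real_derivative - 2 * \<sigma> * \<beta> t * m t * x * y) (at t)"
    unfolding W_def by (auto intro!: derivative_eq_intros DERIV_m assms)
  have "((\<lambda>t. E t x y) has_real_derivative (\<sigma> * m t * (x + y) - B / (2 * \<sigma>)) * E t x y) (at t)"
    unfolding E_def by (auto intro!: derivative_eq_intros DERIV_\<beta> assms)
      (use \<sigma>_pos in simp)
  from DERIV_mult[OF this DERIV_chain2[OF DERIV_bessel_G[OF \<nu>_nonneg W_pos[OF assms]] W]]
  show ?thesis by (simp add: Q_def Qt_def algebra_simps)
qed

text \<open>The terms in \<open>bessel_G'\<close> agree as they stand, thanks to the decay rate of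
  m. For the terms in \<open>bessel_G\<close>, the relation \<beta>^2 = m + A/(4\<sigma>^2) splits
  \<sigma> x \<beta>^2 into \<sigma> m x, which occurs in \<open>Qt\<close>, and the potential A
  x/(4\<sigma>).\<close>

lemma Q_pde:
  assumes "t > 0" "x > 0" "y > 0"
  shows "Qt t x y = \<sigma> * x * Qxx t x y
     - (A * x / (4 * \<sigma>) + B / (2 * \<sigma>) + \<sigma> * ((\<nu>\<^sup>2 - 1) / 4) / x) * Q t x y"
proof -
  define G G' Z \<kappa> where "G = bessel_G \<nu> (W t x y)" and "G' = bessel_G' \<nu> (W t x y)"
    and "Z = E t x y" and "\<kappa> = (\<nu>\<^sup>2 - 1) / 4"
  have "\<sigma> * x * ((\<beta> t)\<^sup>2 + m t * y / x + \<kappa> / x\<^sup>2) = \<sigma> * x * (\<beta> t)\<^sup>2 + \<sigma> * m t * y + \<sigma> * \<kappa> / x"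
    using assms by (simp add: distrib_left power2_eq_square)
  moreover have "\<sigma> * x * (\<beta> t)\<^sup>2 = \<sigma> * m t * x + A * x / (4 * \<sigma>)"
    using \<sigma>_pos unfolding \<beta>_sq[OF assms(1)] by (simp add: distrib_left power2_eq_square)
  ultimately have "\<sigma> * x * ((\<beta> t)\<^sup>2 + m t * y / x + \<kappa> / x\<^sup>2)
      - (A * x / (4 * \<sigma>) + B / (2 * \<sigma>) + \<sigma> * \<kappa> / x) = \<sigma> * m t * (x + y) - B / (2 * \<sigma>)"
    by (simp add: algebra_simps)
  then have "Z * ((\<sigma> * m t * (x + y) - B / (2 * \<sigma>)) * G - 2 * \<sigma> * \<beta> t * m t * x * y * G')
      = \<sigma> * x * (Z * (((\<beta> t)\<^sup>2 + m t * y / x + \<kappa> / x\<^sup>2) * G - 2 * \<beta> t * m t * y * G'))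
        - (A * x / (4 * \<sigma>) + B / (2 * \<sigma>) + \<sigma> * \<kappa> / x) * (Z * G)"
    by (simp only: flip: \<open>_ = \<sigma> * m t * (x + y) - B / (2 * \<sigma>)\<close>) (simp add: algebra_simps)
  then show ?thesis
    by (simp add: Qt_def Qxx_def Q_def G_def G'_def Z_def \<kappa>_def)
qed

lemma continuous_on_kernels:
  assumes "x > 0" "a > 0"
  shows "continuous_on ({0<..} \<times> {a..b}) (\<lambda>(t, y). Q t x y)"
    and "continuous_on ({0<..} \<times> {a..b}) (\<lambda>(t, y). Qt t x y)"
    and "t > 0 \<Longrightarrow> continuous_on ({0<..} \<times> {a..b}) (\<lambda>(x, y). Q t x y)"
    and "t > 0 \<Longrightarrow> continuous_on ({0<..} \<times> {a..b}) (\<lambda>(x, y). Qx t x y)"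
    and "t > 0 \<Longrightarrow> continuous_on ({0<..} \<times> {a..b}) (\<lambda>(x, y). Qxx t x y)"
proof -
  have G: "continuous_on {0<..} (bessel_G \<nu>)" "continuous_on {0<..} (bessel_G' \<nu>)"
    by (auto intro!: continuous_at_imp_continuous_on intro: DERIV_isCont[OF DERIV_bessel_G[OF \<nu>_nonneg]]
        DERIV_isCont[OF DERIV_bessel_G'[OF \<nu>_nonneg]])
  have c: "continuous_on {0<..} \<beta>" "continuous_on {0<..} m"
    by (auto intro!: continuous_at_imp_continuous_on intro: DERIV_isCont[OF DERIV_\<beta>] DERIV_isCont[OF DERIV_m])
  note [continuous_intros] = G[THEN continuous_on_compose2] c[THEN continuous_on_compose2]
  show "continuous_on ({0<..} \<times> {a..b}) (\<lambda>(t, y). Q t x y)"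
    and "continuous_on ({0<..} \<times> {a..b}) (\<lambda>(t, y). Qt t x y)"
    and "t > 0 \<Longrightarrow> continuous_on ({0<..} \<times> {a..b}) (\<lambda>(x, y). Q t x y)"
    and "t > 0 \<Longrightarrow> continuous_on ({0<..} \<times> {a..b}) (\<lambda>(x, y). Qx t x y)"
    and "t > 0 \<Longrightarrow> continuous_on ({0<..} \<times> {a..b}) (\<lambda>(x, y). Qxx t x y)"
    using assms \<sigma>_pos unfolding case_prod_unfold Q_def Qt_def Qx_def Qxx_def E_def W_def
    by (auto intro!: continuous_intros mult_pos_pos m_pos)
qed

end

section \<open>Differentiation under the integral sign\<close>

text \<open>One Leibniz rule serves both variables, s standing for t or for x. The parameter set is
  open, so the derivative within it is the full derivative.\<close>

lemma DERIV_integral_kernel: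
  fixes k k' :: "real \<Rightarrow> real \<Rightarrow> real"
  assumes \<rho>: "continuous_on {a..b} \<rho>"
    and k: "continuous_on ({0<..} \<times> {a..b}) (\<lambda>(s, y). k s y)"
    and k': "continuous_on ({0<..} \<times> {a..b}) (\<lambda>(s, y). k' s y)"
    and deriv: "\<And>s y. s > 0 \<Longrightarrow> y \<in> {a..b} \<Longrightarrow> ((\<lambda>s. k s y) has_real_derivative k' s y) (at s)"
    and "s > 0"
  shows "((\<lambda>s. integral {a..b} (\<lambda>y. \<rho> y * k s y)) has_real_derivative
    integral {a..b} (\<lambda>y. \<rho> y * k' s y)) (at s)"
proof -
  have "((\<lambda>s. integral (cbox a b) (\<lambda>y. \<rho> y * k s y)) has_real_derivative
    integral (cbox a b) (\<lambda>y. \<rho> y * k' s y)) (at s within {0<..})"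
  proof (rule leibniz_rule_field_derivative)
    show "continuous_on ({0<..} \<times> cbox a b) (\<lambda>(s, y). \<rho> y * k' s y)"
      using k' unfolding case_prod_unfold cbox_interval
      by (intro continuous_on_mult continuous_on_compose2[OF \<rho>] continuous_on_snd continuous_on_id) auto
    fix s :: real assume "s \<in> {0<..}"
    then have "continuous_on {a..b} (\<lambda>y. k s y)"
      by (intro continuous_on_compose2[OF k, of _ "\<lambda>y. (s, y)", unfolded case_prod_conv] continuous_intros) auto
    then show "(\<lambda>y. \<rho> y * k s y) integrable_on cbox a b"
      unfolding cbox_interval by (intro integrable_continuous_interval continuous_on_mult \<rho>)
    fix y assume "y \<in> cbox a b"
    then have "((\<lambda>s. \<rho> y * k s y) has_real_derivative \<rho> y * k' s y) (at s)"
      using \<open>s \<in> {0<..}\<close> by (intro DERIV_cmult deriv) auto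
    then show "((\<lambda>s. \<rho> y * k s y) has_real_derivative \<rho> y * k' s y) (at s within {0<..})"
      by (rule has_field_derivative_at_within)
  qed (use \<open>s > 0\<close> in auto)
  then show ?thesis using \<open>s > 0\<close> by (simp add: at_within_open[of _ "{0<..}"])
qed

context bessel_kernel
begin

text \<open>Superposition: the coefficients of the equation do not depend on y and come out of the
  integral, so the pointwise equation for \<open>Q\<close> carries over.\<close>

lemma pde_integral:
  assumes \<rho>: "continuous_on {a..b} \<rho>" and "a > 0"
  defines "I k \<equiv> (\<lambda>t x. integral {a..b} (\<lambda>y. \<rho> y * k t x y))"
  assumes t: "t > 0" and x: "x > 0"
  shows "((\<lambda>t. I Q t x) has_real_derivative I Qt t x) (at t)"
    and "((\<lambda>x. I Q t x) has_real_derivative I Qx t x) (at x)"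
    and "((\<lambda>x. I Qx t x) has_real_derivative I Qxx t x) (at x)"
    and "I Qt t x = \<sigma> * x * I Qxx t x
      - (A * x / (4 * \<sigma>) + B / (2 * \<sigma>) + \<sigma> * ((\<nu>\<^sup>2 - 1) / 4) / x) * I Q t x"
proof -
  note c = continuous_on_kernels[OF x \<open>a > 0\<close>, where b = b]
  show "((\<lambda>t. I Q t x) has_real_derivative I Qt t x) (at t)"
    unfolding I_def using \<open>a > 0\<close> x by (intro DERIV_integral_kernel \<rho> c t DERIV_Q_t) auto
  show "((\<lambda>x. I Q t x) has_real_derivative I Qx t x) (at x)"
    unfolding I_def using \<open>a > 0\<close> t by (intro DERIV_integral_kernel \<rho> c x DERIV_Q_x) auto
  show "((\<lambda>x. I Qx t x) has_real_derivative I Qxx t x) (at x)"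
    unfolding I_def using \<open>a > 0\<close> t by (intro DERIV_integral_kernel \<rho> c x DERIV_Qx_x) auto
  define P where "P = A * x / (4 * \<sigma>) + B / (2 * \<sigma>) + \<sigma> * ((\<nu>\<^sup>2 - 1) / 4) / x"
  have int: "(\<lambda>y. \<rho> y * k x y) integrable_on {a..b}"
    if "continuous_on ({0<..} \<times> {a..b}) (\<lambda>(x, y). k x y)" for k
    by (intro integrable_continuous_interval continuous_on_mult \<rho>
        continuous_on_compose2[OF that, of _ "\<lambda>y. (x, y)", unfolded case_prod_conv] continuous_intros)
      (use x in auto)
  have pde: "Qt t x y = \<sigma> * x * Qxx t x y - P * Q t x y" if "y > 0" for y
    unfolding P_def by (rule Q_pde[OF t x that])
  have "I Qt t x = integral {a..b} (\<lambda>y. \<sigma> * x * (\<rho> y * Qxx t x y) - P * (\<rho> y * Q t x y))"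
    unfolding I_def by (rule Henstock_Kurzweil_Integration.integral_cong)
      (use \<open>a > 0\<close> in \<open>simp add: pde algebra_simps\<close>)
  also have "\<dots> = \<sigma> * x * I Qxx t x - P * I Q t x"
    unfolding I_def using int[OF c(3)[OF t]] int[OF c(5)[OF t]]
    by (subst Henstock_Kurzweil_Integration.integral_diff) (auto intro: integrable_on_mult_right)
  finally show "I Qt t x = \<sigma> * x * I Qxx t x
      - (A * x / (4 * \<sigma>) + B / (2 * \<sigma>) + \<sigma> * ((\<nu>\<^sup>2 - 1) / 4) / x) * I Q t x"
    by (simp add: P_def)
qed

section \<open>Convergence to the initial data\<close>

text \<open>The concentrating part of Q/y: a noncentral chi-squared density scaled so that its mass
  tends to 1 as \<beta> tends to infinity. The pair argument suits the joint limit in (t,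
  x).\<close>

definition D :: "real \<times> real \<Rightarrow> real \<Rightarrow> real" where
  "D = (\<lambda>(t, x) y. m t powr ((1 + \<nu>) / 2) * exp (- \<beta> t * x) * mixture_density \<nu> (m t * x) (\<beta> t) y)"

text \<open>The mixture needs the power y^\<nu>, whereas Q/y carries y^((1+\<nu>)/2 - 1). The
  compensating power of y is continuous on y > 0 and can be attached to the test function.\<close>

lemma Q_eq_D:
  assumes "t > 0" "x > 0" "y > 0"
  shows "Q t x y / y = exp (- B * t / (2 * \<sigma>)) * x powr ((1 + \<nu>) / 2) * (y powr - ((1 + \<nu>) / 2) * D (t, x) y)"
proof -
  have "y powr ((1 + \<nu>) / 2) / y = y powr ((1 + \<nu>) / 2 - 1)"
    using assms by (subst powr_diff) simp
  also have "(1 + \<nu>) / 2 - 1 = - ((1 + \<nu>) / 2) + \<nu>" by (simp add: field_simps)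
  also have "y powr \<dots> = y powr - ((1 + \<nu>) / 2) * y powr \<nu>" by (rule powr_add)
  finally have y: "y powr ((1 + \<nu>) / 2) / y = y powr - ((1 + \<nu>) / 2) * y powr \<nu>" .
  have "E t x y = exp (- B * t / (2 * \<sigma>)) * exp (- \<beta> t * x) * exp (- \<beta> t * y)"
    unfolding E_def exp_add[symmetric] by (simp add: algebra_simps)
  moreover have "W t x y powr ((1 + \<nu>) / 2)
      = m t powr ((1 + \<nu>) / 2) * x powr ((1 + \<nu>) / 2) * y powr ((1 + \<nu>) / 2)"
    using assms m_pos[of t] by (simp add: W_def powr_mult)
  ultimately have "Q t x y / y = exp (- B * t / (2 * \<sigma>)) * exp (- \<beta> t * x) * exp (- \<beta> t * y)
      * (m t powr ((1 + \<nu>) / 2) * x powr ((1 + \<nu>) / 2) * (y powr ((1 + \<nu>) / 2) / y)) * bessel_series \<nu> (m t * x * y)"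
    by (simp add: Q_def bessel_G_def W_def)
  then show ?thesis
    unfolding y using assms by (simp add: D_def mixture_density_def)
qed

text \<open>All is expressed through 1/\<beta>, which will tend to 0. By the relation between
  \<beta>^2 and m, the ratio r = m/\<beta>^2 is near 1, and the growth of exp(m x/\<beta>) cancels
  against exp(-\<beta> x) up to a factor tending to 1.\<close>

lemma D_moments:
  assumes t: "t > 0" and x: "x > 0" and \<beta>: "\<beta> t > 0"
  defines "r \<equiv> 1 - A / (4 * \<sigma>\<^sup>2) * (inverse (\<beta> t))\<^sup>2"
  defines "M \<equiv> r powr ((1 + \<nu>) / 2) * exp (- x * A / (4 * \<sigma>\<^sup>2) * inverse (\<beta> t))"
  shows "has_bochner_integral lborel (D (t, x)) M"
    and "has_bochner_integral lborel (\<lambda>y. (y - a)\<^sup>2 * D (t, x) y)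
      (M * ((r * x)\<^sup>2 + (2 * \<nu> + 4) * (r * x) * inverse (\<beta> t) + (\<nu> + 1) * (\<nu> + 2) * (inverse (\<beta> t))\<^sup>2
        - 2 * a * (r * x + (\<nu> + 1) * inverse (\<beta> t)) + a\<^sup>2))"
proof -
  define N where "N = m t powr ((1 + \<nu>) / 2) * exp (- \<beta> t * x)"
  define l where "l = m t * x / \<beta> t"
  note mom = mixture_density_moments[OF \<nu>_nonneg _ \<beta>, of "m t * x", folded l_def]
  have q: "m t * x \<ge> 0" using m_pos[OF t] x by simp
  have D: "D (t, x) = (\<lambda>y. N * mixture_density \<nu> (m t * x) (\<beta> t) y)"
    by (simp add: D_def N_def)
  have mt: "m t = (\<beta> t)\<^sup>2 - A / (4 * \<sigma>\<^sup>2)" using \<beta>_sq[OF t] by simp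
  have r: "r = m t / (\<beta> t)\<^sup>2"
    unfolding r_def mt using \<beta> by (simp add: diff_divide_distrib power_inverse divide_inverse[symmetric])
  have "\<beta> t powr (\<nu> + 1) = ((\<beta> t)\<^sup>2) powr ((1 + \<nu>) / 2)"
  proof -
    have "(\<beta> t)\<^sup>2 = \<beta> t powr 2" using \<beta> powr_realpow[of "\<beta> t" 2] by simp
    then show ?thesis by (simp only: powr_powr) (simp add: add_divide_distrib add.commute)
  qed
  then have p: "m t powr ((1 + \<nu>) / 2) / \<beta> t powr (\<nu> + 1) = r powr ((1 + \<nu>) / 2)"
    unfolding r using m_pos[OF t] \<beta> by (simp add: powr_divide)
  have "l - \<beta> t * x = - x * A / (4 * \<sigma>\<^sup>2) * inverse (\<beta> t)"
  proof -
    have "((\<beta> t)\<^sup>2 - k) * x / \<beta> t - \<beta> t * x = - (x * k) * inverse (\<beta> t)" for k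
      using \<beta> by (simp add: field_simps power2_eq_square)
    then show ?thesis unfolding l_def mt by simp
  qed
  then have "exp l * exp (- \<beta> t * x) = exp (- x * A / (4 * \<sigma>\<^sup>2) * inverse (\<beta> t))"
    by (simp flip: exp_add)
  then have M: "N * (exp l / \<beta> t powr (\<nu> + 1)) = M"
    unfolding M_def p[symmetric] N_def by (simp add: mult_ac)
  have lr: "l / \<beta> t = r * x" unfolding l_def r by (simp add: power2_eq_square)
  show "has_bochner_integral lborel (D (t, x)) M"
    unfolding D M[symmetric] by (intro has_bochner_integral_mult_right mom q)
  have "has_bochner_integral lborel (\<lambda>y. N * (y\<^sup>2 * mixture_density \<nu> (m t * x) (\<beta> t) y)
      - 2 * a * (N * (y * mixture_density \<nu> (m t * x) (\<beta> t) y)) + a\<^sup>2 * (N * mixture_density \<nu> (m t * x) (\<beta> t) y))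
    (N * (exp l / \<beta> t powr (\<nu> + 1) * ((l\<^sup>2 + (2 * \<nu> + 4) * l + (\<nu> + 1) * (\<nu> + 2)) / (\<beta> t)\<^sup>2))
      - 2 * a * (N * (exp l / \<beta> t powr (\<nu> + 1) * ((l + \<nu> + 1) / \<beta> t)))
      + a\<^sup>2 * (N * (exp l / \<beta> t powr (\<nu> + 1))))"
    by (intro has_bochner_integral_mult_right has_bochner_integral_add has_bochner_integral_diff mom q)
  moreover have "(\<lambda>y. N * (y\<^sup>2 * mixture_density \<nu> (m t * x) (\<beta> t) y)
      - 2 * a * (N * (y * mixture_density \<nu> (m t * x) (\<beta> t) y)) + a\<^sup>2 * (N * mixture_density \<nu> (m t * x) (\<beta> t) y))
    = (\<lambda>y. (y - a)\<^sup>2 * D (t, x) y)"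
    by (simp add: D fun_eq_iff power2_diff algebra_simps)
  moreover have "N * (exp l / \<beta> t powr (\<nu> + 1) * ((l\<^sup>2 + (2 * \<nu> + 4) * l + (\<nu> + 1) * (\<nu> + 2)) / (\<beta> t)\<^sup>2))
      - 2 * a * (N * (exp l / \<beta> t powr (\<nu> + 1) * ((l + \<nu> + 1) / \<beta> t)))
      + a\<^sup>2 * (N * (exp l / \<beta> t powr (\<nu> + 1)))
    = M * ((l / \<beta> t)\<^sup>2 + (2 * \<nu> + 4) * (l / \<beta> t) * inverse (\<beta> t) + (\<nu> + 1) * (\<nu> + 2) * (inverse (\<beta> t))\<^sup>2
        - 2 * a * (l / \<beta> t + (\<nu> + 1) * inverse (\<beta> t)) + a\<^sup>2)"
    unfolding M[symmetric] by (simp add: divide_inverse power_inverse power2_eq_square algebra_simps)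
  ultimately show "has_bochner_integral lborel (\<lambda>y. (y - a)\<^sup>2 * D (t, x) y)
      (M * ((r * x)\<^sup>2 + (2 * \<nu> + 4) * (r * x) * inverse (\<beta> t) + (\<nu> + 1) * (\<nu> + 2) * (inverse (\<beta> t))\<^sup>2
        - 2 * a * (r * x + (\<nu> + 1) * inverse (\<beta> t)) + a\<^sup>2))"
    by (simp only: lr)
qed

text \<open>The second moment is taken about the fixed point x0 rather than the moving x. Its limit
  is x0^2 - 2 x0^2 + x0^2 = 0, which controls the spread and the displacement of x together.\<close>

lemma tendsto_integral_D:
  assumes \<beta>: "filterlim \<beta> at_top (at_right 0)" and "x0 > 0"
    and \<psi>: "\<psi> \<in> borel_measurable borel" "\<And>y. \<bar>\<psi> y\<bar> \<le> K" "isCont \<psi> x0"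
  shows "((\<lambda>p. LINT y|lborel. \<psi> y * D p y) \<longlongrightarrow> \<psi> x0) (at (0, x0) within {0<..} \<times> {0<..})"
proof -
  define F where "F = at (0::real, x0) within {0<..} \<times> {0<..}"
  have pos: "eventually (\<lambda>p. fst p > 0 \<and> snd p > 0) F"
    unfolding F_def eventually_at_filter by (intro always_eventually) auto
  \<comment> \<open>Restricting the filter to t > 0 is essential here: \<beta> is only known to
    diverge from the right.\<close>
  have fst: "filterlim fst (at_right 0) F"
    unfolding filterlim_at
  proof
    show "eventually (\<lambda>p. fst p \<in> {0<..} \<and> fst p \<noteq> 0) F"
      using pos by eventually_elim auto
    show "(fst \<longlongrightarrow> 0) F" unfolding F_def by (auto intro!: tendsto_eq_intros)
  qed
  have snd: "(snd \<longlongrightarrow> x0) F" unfolding F_def by (auto intro!: tendsto_eq_intros)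
  have \<beta>F: "filterlim (\<lambda>p. \<beta> (fst p)) at_top F" by (rule filterlim_compose[OF \<beta> fst])
  then have \<beta>_pos: "eventually (\<lambda>p. \<beta> (fst p) > 0) F" by (auto simp: filterlim_at_top_dense)
  have inv: "((\<lambda>p. inverse (\<beta> (fst p))) \<longlongrightarrow> 0) F"
    by (rule filterlim_compose[OF tendsto_inverse_0_at_top[OF filterlim_ident] \<beta>F])
  define r where "r p = 1 - A / (4 * \<sigma>\<^sup>2) * (inverse (\<beta> (fst p)))\<^sup>2" for p :: "real \<times> real"
  define M where "M p = r p powr ((1 + \<nu>) / 2) * exp (- snd p * A / (4 * \<sigma>\<^sup>2) * inverse (\<beta> (fst p)))" for p
  define V where "V p = M p * ((r p * snd p)\<^sup>2 + (2 * \<nu> + 4) * (r p * snd p) * inverse (\<beta> (fst p))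
      + (\<nu> + 1) * (\<nu> + 2) * (inverse (\<beta> (fst p)))\<^sup>2
      - 2 * x0 * (r p * snd p + (\<nu> + 1) * inverse (\<beta> (fst p))) + x0\<^sup>2)" for p
  have "(r \<longlongrightarrow> 1 - A / (4 * \<sigma>\<^sup>2) * 0\<^sup>2) F" unfolding r_def by (intro tendsto_intros inv)
  then have r: "(r \<longlongrightarrow> 1) F" by simp
  have "(M \<longlongrightarrow> 1 powr ((1 + \<nu>) / 2) * exp (- x0 * A / (4 * \<sigma>\<^sup>2) * 0)) F"
    unfolding M_def divide_inverse by (intro tendsto_intros inv r snd) auto
  then have M: "(M \<longlongrightarrow> 1) F" by simp
  have "(V \<longlongrightarrow> 1 * ((1 * x0)\<^sup>2 + (2 * \<nu> + 4) * (1 * x0) * 0 + (\<nu> + 1) * (\<nu> + 2) * 0\<^sup>2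
      - 2 * x0 * (1 * x0 + (\<nu> + 1) * 0) + x0\<^sup>2)) F"
    unfolding V_def by (intro tendsto_intros inv r snd M)
  then have V: "(V \<longlongrightarrow> 0) F" by (simp add: power2_eq_square)
  show ?thesis
    unfolding F_def[symmetric]
  proof (rule concentrating_densities_tendsto[OF \<psi> _ _ M _ V])
    show "eventually (\<lambda>p. \<forall>y. D p y \<ge> 0) F"
      using pos by eventually_elim
        (auto simp: D_def intro!: mult_nonneg_nonneg mixture_density_nonneg \<nu>_nonneg less_imp_le[OF m_pos])
    show "eventually (\<lambda>p. has_bochner_integral lborel (D p) (M p)) F"
      using pos \<beta>_pos by eventually_elim
        (use D_moments(1) in \<open>auto simp: M_def r_def\<close>)
    show "eventually (\<lambda>p. has_bochner_integral lborel (\<lambda>y. (y - x0)\<^sup>2 * D p y) (V p)) F"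
      using pos \<beta>_pos by eventually_elim
        (use D_moments(2) in \<open>auto simp: V_def M_def r_def\<close>)
  qed
qed

end

subsection \<open>The fundamental solution\<close>

text \<open>An enclosing interval bounded away from 0 is the integration domain that the Leibniz
  rule works on; empty support is covered by a degenerate interval.\<close>

lemma test_function_support:
  assumes "test_function \<phi>"
  obtains a b where "0 < a" "a \<le> b" "\<And>y. y \<notin> {a..b} \<Longrightarrow> \<phi> y = 0"
proof -
  obtain K where K: "compact K" "K \<subseteq> {0<..}" "\<And>y. y \<notin> K \<Longrightarrow> \<phi> y = 0"
    using assms unfolding test_function_def by blast
  show ?thesis
  proof (cases "K = {}")
    case True
    then show ?thesis using that[of 1 1] K(3) by auto
  next
    case False
    obtain a where a: "a \<in> K" "\<forall>y\<in>K. a \<le> y" using compact_attains_inf[OF K(1) False] by blast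
    obtain b where b: "b \<in> K" "\<forall>y\<in>K. y \<le> b" using compact_attains_sup[OF K(1) False] by blast
    show ?thesis
      using that[of a b] a b K(2,3) by (meson atLeastAtMost_iff greaterThan_iff subsetD)
  qed
qed

lemma bessel_G_eq_bessel_I:
  assumes "w > 0"
  shows "sqrt w * bessel_I \<nu> (2 * sqrt w) = bessel_G \<nu> w"
proof -
  have "sqrt w * sqrt w powr \<nu> = w powr ((1 + \<nu>) / 2)"
    using assms by (simp add: powr_half_sqrt[symmetric] powr_powr flip: powr_add) (simp add: add_divide_distrib)
  moreover have "(2 * sqrt w)\<^sup>2 / 4 = w" using assms by (simp add: power_mult_distrib)
  ultimately show ?thesis
    by (simp add: bessel_I_def bessel_G_def bessel_series_def mult.assoc[symmetric])
qed

text \<open>The quadrant t, x > 0 is open, so derivatives at its points only see values inside it,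
  where the explicit formula for the solution is available.\<close>

lemma solves_pde_cong:
  assumes "\<And>t x. t > 0 \<Longrightarrow> x > 0 \<Longrightarrow> u t x = v t x" and "solves_pde \<sigma> f \<mu> v"
  shows "solves_pde \<sigma> f \<mu> u"
proof -
  obtain ut ux uxx where v: "\<And>t x. t > 0 \<Longrightarrow> x > 0 \<Longrightarrow>
      ((\<lambda>s. v s x) has_real_derivative ut t x) (at t) \<and>
      ((\<lambda>z. v t z) has_real_derivative ux t x) (at x) \<and>
      ((\<lambda>z. ux t z) has_real_derivative uxx t x) (at x) \<and>
      ut t x = \<sigma> * x * uxx t x + f x * ux t x - \<mu> * x * v t x"
    using assms(2) unfolding solves_pde_def by blast
  show ?thesis unfolding solves_pde_def
  proof (intro exI allI impI)
    fix t x :: real assume tx: "t > 0" "x > 0"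
    have "((\<lambda>s. u s x) has_real_derivative ut t x) (at t)"
      by (rule has_field_derivative_transform_within_open[OF conjunct1[OF v[OF tx]], of "{0<..}"])
        (use tx assms(1) in auto)
    moreover have "((\<lambda>z. u t z) has_real_derivative ux t x) (at x)"
      by (rule has_field_derivative_transform_within_open[OF conjunct1[OF conjunct2[OF v[OF tx]]], of "{0<..}"])
        (use tx assms(1) in auto)
    ultimately show "((\<lambda>s. u s x) has_real_derivative ut t x) (at t) \<and>
        ((\<lambda>z. u t z) has_real_derivative ux t x) (at x) \<and>
        ((\<lambda>z. ux t z) has_real_derivative uxx t x) (at x) \<and>
        ut t x = \<sigma> * x * uxx t x + f x * ux t x - \<mu> * x * u t x"
      using v[OF tx] assms(1)[OF tx] by simp
  qed
qed

text \<open>The gauge factor \<open>exp (- F / (2 * \<sigma>))\<close> removes the drift, and the Riccati equation identifies the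
  resulting potential.\<close>

lemma solves_pde_gauge:
  fixes \<sigma> \<mu> A B C :: real and f F :: "real \<Rightarrow> real"
  assumes "\<sigma> > 0"
    and riccati: "\<And>x. x > 0 \<Longrightarrow> \<exists>f'. (f has_real_derivative f') (at x) \<and>
        \<sigma> * x * f' - \<sigma> * f x + (1/2) * (f x)\<^sup>2 + 2 * \<sigma> * \<mu> * x\<^sup>2
          = (1/2) * A * x\<^sup>2 + B * x + C"
    and F: "\<And>x. x > 0 \<Longrightarrow> (F has_real_derivative f x / x) (at x)"
    and Vt: "\<And>t x. t > 0 \<Longrightarrow> x > 0 \<Longrightarrow> ((\<lambda>t. V t x) has_real_derivative Vt t x) (at t)"
    and Vx: "\<And>t x. t > 0 \<Longrightarrow> x > 0 \<Longrightarrow> ((\<lambda>x. V t x) has_real_derivative Vx t x) (at x)"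
    and Vxx: "\<And>t x. t > 0 \<Longrightarrow> x > 0 \<Longrightarrow> ((\<lambda>x. Vx t x) has_real_derivative Vxx t x) (at x)"
    and pde: "\<And>t x. t > 0 \<Longrightarrow> x > 0 \<Longrightarrow>
      Vt t x = \<sigma> * x * Vxx t x - (A * x / (4 * \<sigma>) + B / (2 * \<sigma>) + C / (2 * \<sigma>) / x) * V t x"
  shows "solves_pde \<sigma> f \<mu> (\<lambda>t x. exp (- F x / (2 * \<sigma>)) * V t x)"
proof -
  obtain f' where f': "\<And>x. x > 0 \<Longrightarrow> (f has_real_derivative f' x) (at x)"
    and eq: "\<And>x. x > 0 \<Longrightarrow> \<sigma> * x * f' x - \<sigma> * f x + (1/2) * (f x)\<^sup>2 + 2 * \<sigma> * \<mu> * x\<^sup>2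
          = (1/2) * A * x\<^sup>2 + B * x + C"
    using riccati by metis
  define h where "h x = exp (- F x / (2 * \<sigma>))" for x
  \<comment> \<open>This is F'/(2\<sigma>), minus the logarithmic derivative of \<open>h\<close>; in
    these terms derivatives of h V keep the common factor h.\<close>
  define q where "q x = f x / (2 * \<sigma> * x)" for x
  define q' where "q' x = (f' x * x - f x) / (2 * \<sigma> * x\<^sup>2)" for x
  have h: "(h has_real_derivative - q x * h x) (at x)" if "x > 0" for x
    unfolding h_def q_def using that F[OF that] \<open>\<sigma> > 0\<close>
    by (auto intro!: derivative_eq_intros simp: mult_ac)
  have q: "(q has_real_derivative q' x) (at x)" if "x > 0" for x
  proof -
    have "(q has_real_derivative (f' x * (2 * \<sigma> * x) - f x * (2 * \<sigma>)) / ((2 * \<sigma> * x) * (2 * \<sigma> * x))) (at x)"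
      unfolding q_def using that \<open>\<sigma> > 0\<close>
      by (intro DERIV_divide f') (auto intro!: derivative_eq_intros)
    also have "(f' x * (2 * \<sigma> * x) - f x * (2 * \<sigma>)) / ((2 * \<sigma> * x) * (2 * \<sigma> * x)) = q' x"
      unfolding q'_def using that \<open>\<sigma> > 0\<close> by (simp add: power2_eq_square field_simps)
    finally show ?thesis .
  qed
  show ?thesis
    unfolding solves_pde_def h_def[symmetric]
  proof (intro exI allI impI conjI)
    fix t x :: real assume t: "t > 0" and x: "x > 0"
    show "((\<lambda>s. h x * V s x) has_real_derivative h x * Vt t x) (at t)"
      by (intro DERIV_cmult Vt t x)
    show "((\<lambda>z. h z * V t z) has_real_derivative h x * (Vx t x - q x * V t x)) (at x)"
      using DERIV_mult[OF h[OF x] Vx[OF t x]] by (simp add: algebra_simps)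
    show "((\<lambda>z. h z * (Vx t z - q z * V t z)) has_real_derivative
        h x * (Vxx t x - 2 * q x * Vx t x + ((q x)\<^sup>2 - q' x) * V t x)) (at x)"
      using DERIV_mult[OF h[OF x] DERIV_diff[OF Vxx[OF t x] DERIV_mult[OF q[OF x] Vx[OF t x]]]]
      by (simp add: algebra_simps power2_eq_square)
    \<comment> \<open>With this form of f, the contributions of f V_x and -2\<sigma> x q V_x cancel.
      The remaining multiple of V is -(\<sigma> x q^2 + \<sigma> x q' + \<mu> x), and that bracket
      is the left side of the Riccati equation divided by 2\<sigma> x.\<close>
    have fq: "f x = 2 * \<sigma> * x * q x" unfolding q_def using x \<open>\<sigma> > 0\<close> by simp
    have "\<sigma> * x * (q x)\<^sup>2 + \<sigma> * x * q' x + \<mu> * x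
        = (\<sigma> * x * f' x - \<sigma> * f x + (1/2) * (f x)\<^sup>2 + 2 * \<sigma> * \<mu> * x\<^sup>2) / (2 * \<sigma> * x)"
      unfolding q_def q'_def using x \<open>\<sigma> > 0\<close> by (simp add: power2_eq_square field_simps)
    also have "\<dots> = A * x / (4 * \<sigma>) + B / (2 * \<sigma>) + C / (2 * \<sigma>) / x"
      unfolding eq[OF x] using x \<open>\<sigma> > 0\<close> by (simp add: power2_eq_square field_simps)
    finally have pot: "A * x / (4 * \<sigma>) + B / (2 * \<sigma>) + C / (2 * \<sigma>) / x
        = \<sigma> * x * (q x)\<^sup>2 + \<sigma> * x * q' x + \<mu> * x" by simp
    show "h x * Vt t x = \<sigma> * x * (h x * (Vxx t x - 2 * q x * Vx t x + ((q x)\<^sup>2 - q' x) * V t x))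
        + f x * (h x * (Vx t x - q x * V t x)) - \<mu> * x * (h x * V t x)"
      unfolding pde[OF t x] pot fq by (simp add: algebra_simps power2_eq_square)
  qed
qed

section \<open>The hyperbolic coefficients\<close>

text \<open>Everything rests on cosh^2 = sinh^2 + 1, used for \<beta>^2 and for the derivative of
  the hyperbolic cotangent.\<close>

lemma bessel_kernel_hyperbolic:
  assumes "\<sigma> > 0" "A > 0" "\<nu> \<ge> 0"
  shows "bessel_kernel \<sigma> A \<nu>
    (\<lambda>t. sqrt A / (2 * \<sigma>) * (cosh (sqrt A * t / 2) / sinh (sqrt A * t / 2)))
    (\<lambda>t. A / (4 * \<sigma>\<^sup>2) / (sinh (sqrt A * t / 2))\<^sup>2)"
proof
  show "\<sigma> > 0" "\<nu> \<ge> 0" by fact+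
  fix t :: real assume t: "t > 0"
  define s c where "s = sinh (sqrt A * t / 2)" and "c = cosh (sqrt A * t / 2)"
  have s: "s > 0" unfolding s_def using t \<open>A > 0\<close> by simp
  have cs: "c\<^sup>2 = s\<^sup>2 + 1" unfolding s_def c_def by (simp add: cosh_square_eq)
  have ds: "((\<lambda>t. sinh (sqrt A * t / 2)) has_real_derivative c * (sqrt A / 2)) (at t)"
    unfolding c_def by (auto intro!: derivative_eq_intros)
  have dc: "((\<lambda>t. cosh (sqrt A * t / 2)) has_real_derivative s * (sqrt A / 2)) (at t)"
    unfolding s_def by (auto intro!: derivative_eq_intros)
  show "A / (4 * \<sigma>\<^sup>2) / (sinh (sqrt A * t / 2))\<^sup>2 > 0"
    using s assms unfolding s_def[symmetric] by simp
  show "(sqrt A / (2 * \<sigma>) * (cosh (sqrt A * t / 2) / sinh (sqrt A * t / 2)))\<^sup>2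
      = A / (4 * \<sigma>\<^sup>2) / (sinh (sqrt A * t / 2))\<^sup>2 + A / (4 * \<sigma>\<^sup>2)"
    unfolding s_def[symmetric] c_def[symmetric] power_mult_distrib power_divide cs
    using s assms by (simp add: field_simps)
  have "((\<lambda>t. cosh (sqrt A * t / 2) / sinh (sqrt A * t / 2)) has_real_derivative
      (s * (sqrt A / 2) * s - c * (c * (sqrt A / 2))) / (s * s)) (at t)"
    using DERIV_divide[OF dc ds] s unfolding s_def[symmetric] c_def[symmetric] by simp
  also have "s * (sqrt A / 2) * s - c * (c * (sqrt A / 2)) = (s\<^sup>2 - c\<^sup>2) * (sqrt A / 2)"
    by (simp add: power2_eq_square algebra_simps)
  also have "s\<^sup>2 - c\<^sup>2 = - 1" by (simp add: cs)
  finally have "((\<lambda>t. sqrt A / (2 * \<sigma>) * (cosh (sqrt A * t / 2) / sinh (sqrt A * t / 2)))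
      has_real_derivative sqrt A / (2 * \<sigma>) * (- 1 * (sqrt A / 2) / (s * s))) (at t)"
    by (rule DERIV_cmult)
  moreover have "sqrt A / (2 * \<sigma>) * (- 1 * (sqrt A / 2) / (s * s)) = - \<sigma> * (A / (4 * \<sigma>\<^sup>2) / s\<^sup>2)"
    using s assms by (simp add: power2_eq_square field_simps)
  ultimately show "((\<lambda>t. sqrt A / (2 * \<sigma>) * (cosh (sqrt A * t / 2) / sinh (sqrt A * t / 2)))
      has_real_derivative - \<sigma> * (A / (4 * \<sigma>\<^sup>2) / (sinh (sqrt A * t / 2))\<^sup>2)) (at t)"
    by (simp add: s_def)
  have "((\<lambda>t. A / (4 * \<sigma>\<^sup>2) / (sinh (sqrt A * t / 2))\<^sup>2) has_real_derivative
      (0 * s\<^sup>2 - A / (4 * \<sigma>\<^sup>2) * (2 * (c * (sqrt A / 2)) * s)) / (s\<^sup>2 * s\<^sup>2)) (at t)"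
  proof -
    have "((\<lambda>t. (sinh (sqrt A * t / 2))\<^sup>2) has_real_derivative 2 * (c * (sqrt A / 2)) * s) (at t)"
      unfolding s_def c_def by (auto intro!: derivative_eq_intros)
    from DERIV_divide[OF DERIV_const[of "A / (4 * \<sigma>\<^sup>2)"] this] show ?thesis
      using s unfolding s_def[symmetric] power2_eq_square[of "s\<^sup>2"] by simp
  qed
  moreover have "(0 * s\<^sup>2 - A / (4 * \<sigma>\<^sup>2) * (2 * (c * (sqrt A / 2)) * s)) / (s\<^sup>2 * s\<^sup>2)
      = - 2 * \<sigma> * (sqrt A / (2 * \<sigma>) * (c / s)) * (A / (4 * \<sigma>\<^sup>2) / s\<^sup>2)"
    using s assms by (simp add: power2_eq_square field_simps)
  ultimately show "((\<lambda>t. A / (4 * \<sigma>\<^sup>2) / (sinh (sqrt A * t / 2))\<^sup>2) has_real_derivative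
      - 2 * \<sigma> * (sqrt A / (2 * \<sigma>) * (cosh (sqrt A * t / 2) / sinh (sqrt A * t / 2))) *
        (A / (4 * \<sigma>\<^sup>2) / (sinh (sqrt A * t / 2))\<^sup>2)) (at t)"
    by (simp add: s_def c_def)
qed

lemma filterlim_scaled_coth_at_right_0:
  fixes r k :: real
  assumes "r > 0" "k > 0"
  shows "filterlim (\<lambda>t. k * (cosh (r * t / 2) / sinh (r * t / 2))) at_top (at_right 0)"
proof (rule filterlim_tendsto_pos_mult_at_top[OF tendsto_const \<open>k > 0\<close>])
  have "((\<lambda>t. sinh (r * t / 2)) \<longlongrightarrow> sinh (r * 0 / 2)) (at_right 0)"
    by (intro tendsto_intros) auto
  then have "filterlim (\<lambda>t. sinh (r * t / 2)) (at_right 0) (at_right 0)"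
    unfolding filterlim_at using assms by (auto simp: eventually_at_right_less eventually_at_filter)
  then have inv: "filterlim (\<lambda>t. inverse (sinh (r * t / 2))) at_top (at_right 0)"
    by (rule filterlim_compose[OF filterlim_inverse_at_top_right])
  have "((\<lambda>t. cosh (r * t / 2)) \<longlongrightarrow> cosh (r * 0 / 2)) (at_right 0)"
    by (intro tendsto_intros) auto
  then have "((\<lambda>t. cosh (r * t / 2)) \<longlongrightarrow> 1) (at_right 0)" by simp
  from filterlim_tendsto_pos_mult_at_top[OF this zero_less_one inv]
  show "filterlim (\<lambda>t. cosh (r * t / 2) / sinh (r * t / 2)) at_top (at_right 0)"
    by (simp only: divide_inverse)
qed

theorem theorem5p4:
  fixes \<sigma> \<mu> A B C \<nu> :: real and f F :: "real \<Rightarrow> real"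
  assumes "\<sigma> > 0" and "A > 0"
    and riccati: "\<And>x. x > 0 \<Longrightarrow> \<exists>f'. (f has_real_derivative f') (at x) \<and>
        \<sigma> * x * f' - \<sigma> * f x + (1/2) * (f x)\<^sup>2 + 2 * \<sigma> * \<mu> * x\<^sup>2
          = (1/2) * A * x\<^sup>2 + B * x + C"
    and F: "\<And>x. x > 0 \<Longrightarrow> (F has_real_derivative f x / x) (at x)"
    and nu: "\<nu> = sqrt (\<sigma>\<^sup>2 + 2 * C) / \<sigma>"
  shows "\<exists>C1 C2 :: real \<Rightarrow> real.
    fundamental_solution \<sigma> f \<mu> (\<lambda>t x y.
      sqrt (A * x * y) * exp (- (F x - F y) / (2 * \<sigma>)) / (2 * \<sigma> * sinh (sqrt A * t / 2)) *
      exp (- (B * t) / (2 * \<sigma>) - sqrt A * (x + y) / (2 * \<sigma> * tanh (sqrt A * t / 2))) *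
      (C1 y * bessel_I \<nu> (sqrt (A * x * y) / (\<sigma> * sinh (sqrt A * t / 2))) +
       C2 y * bessel_I_neg \<nu> (sqrt (A * x * y) / (\<sigma> * sinh (sqrt A * t / 2)))))"
proof (intro exI)
  \<comment> \<open>The prescribed form already contains exp(F(y)/(2\<sigma>)), so 1/y is the only
    weight left to supply. The final \<open>show\<close> fixes the two witnesses as
    \<open>1 / y\<close> and \<open>0\<close>.\<close>
  define p where "p = (\<lambda>t x y.
      sqrt (A * x * y) * exp (- (F x - F y) / (2 * \<sigma>)) / (2 * \<sigma> * sinh (sqrt A * t / 2)) *
      exp (- (B * t) / (2 * \<sigma>) - sqrt A * (x + y) / (2 * \<sigma> * tanh (sqrt A * t / 2))) *
      (1 / y * bessel_I \<nu> (sqrt (A * x * y) / (\<sigma> * sinh (sqrt A * t / 2))) +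
       0 * bessel_I_neg \<nu> (sqrt (A * x * y) / (\<sigma> * sinh (sqrt A * t / 2)))))"
  have "\<sigma>\<^sup>2 + 2 * C \<ge> 0"
  proof (rule riccati_discriminant_nonneg[OF \<open>\<sigma> > 0\<close>])
    fix x :: real assume "x > 0"
    \<comment> \<open>Moving the \<mu> term to the right only changes the quadratic coefficient,
      which is arbitrary in the lemma.\<close>
    from riccati[OF this]
    show "\<exists>f'. (f has_real_derivative f') (at x) \<and>
        \<sigma> * x * f' - \<sigma> * f x + (1/2) * (f x)\<^sup>2 = (A / 2 - 2 * \<sigma> * \<mu>) * x\<^sup>2 + B * x + C"
      by (auto simp: algebra_simps intro!: exI)
  qed
  then have "\<nu> \<ge> 0" and "\<nu>\<^sup>2 = (\<sigma>\<^sup>2 + 2 * C) / \<sigma>\<^sup>2"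
    using \<open>\<sigma> > 0\<close> by (simp_all add: nu power_divide)
  \<comment> \<open>This matches the 1/x potential satisfied by \<open>Q\<close> with the one that
    the gauge transformation produces, and so explains the value of \<nu>.\<close>
  then have \<kappa>: "\<sigma> * ((\<nu>\<^sup>2 - 1) / 4) = C / (2 * \<sigma>)"
    using \<open>\<sigma> > 0\<close> by (simp add: field_simps power2_eq_square)
  define \<beta> where "\<beta> = (\<lambda>t. sqrt A / (2 * \<sigma>) * (cosh (sqrt A * t / 2) / sinh (sqrt A * t / 2)))"
  define m where "m = (\<lambda>t. A / (4 * \<sigma>\<^sup>2) / (sinh (sqrt A * t / 2))\<^sup>2)"
  interpret bessel_kernel \<sigma> A B \<nu> \<beta> m
    unfolding \<beta>_def m_def by (rule bessel_kernel_hyperbolic) fact+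
  have \<beta>: "filterlim \<beta> at_top (at_right 0)"
    unfolding \<beta>_def using assms by (intro filterlim_scaled_coth_at_right_0) auto
  \<comment> \<open>The prefactor equals sqrt W and the Bessel argument equals 2 sqrt W, so the two
    combine to \<open>bessel_G\<close>. What remains is a gauge factor in x and a weight in
    y.\<close>
  have p_eq: "p t x y = exp (- F x / (2 * \<sigma>)) * (exp (F y / (2 * \<sigma>)) / y * Q t x y)"
    if "t > 0" "x > 0" "y > 0" for t x y
  proof -
    define s where "s = sinh (sqrt A * t / 2)"
    have s: "s > 0" unfolding s_def using that \<open>A > 0\<close> by simp
    have "m t = A / (2 * \<sigma> * s)\<^sup>2" unfolding m_def s_def[symmetric] by (simp add: power_mult_distrib)
    then have "W t x y = (A * x * y) / (2 * \<sigma> * s)\<^sup>2" unfolding W_def by simp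
    then have w: "sqrt (W t x y) = sqrt (A * x * y) / (2 * \<sigma> * s)"
      using s \<open>\<sigma> > 0\<close> by (simp add: real_sqrt_divide real_sqrt_abs abs_mult)
    have "sqrt A * (x + y) / (2 * \<sigma> * tanh (sqrt A * t / 2)) = \<beta> t * (x + y)"
      unfolding \<beta>_def tanh_def by simp
    then have E: "exp (- (B * t) / (2 * \<sigma>) - sqrt A * (x + y) / (2 * \<sigma> * tanh (sqrt A * t / 2))) = E t x y"
      unfolding E_def by simp
    have F: "exp (- (F x - F y) / (2 * \<sigma>)) = exp (- F x / (2 * \<sigma>)) * exp (F y / (2 * \<sigma>))"
      unfolding exp_add[symmetric] by (simp add: diff_divide_distrib)
    have z: "sqrt (A * x * y) / (\<sigma> * s) = 2 * sqrt (W t x y)"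
      unfolding w by simp
    have "p t x y = sqrt (A * x * y) / (2 * \<sigma> * s) * (exp (- F x / (2 * \<sigma>)) * exp (F y / (2 * \<sigma>)))
        * E t x y * (1 / y * bessel_I \<nu> (2 * sqrt (W t x y)))"
      unfolding p_def s_def[symmetric] E F z by simp
    also have "\<dots> = exp (- F x / (2 * \<sigma>)) * (exp (F y / (2 * \<sigma>)) / y
        * (E t x y * (sqrt (W t x y) * bessel_I \<nu> (2 * sqrt (W t x y)))))"
      unfolding w[symmetric] by (simp add: mult_ac)
    finally show ?thesis
      unfolding bessel_G_eq_bessel_I[OF W_pos[OF that]] Q_def .
  qed
  have F_cont: "isCont F x" if "x > 0" for x
    using F[OF that] by (rule DERIV_isCont)
  show "fundamental_solution \<sigma> f \<mu> (\<lambda>t x y.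
      sqrt (A * x * y) * exp (- (F x - F y) / (2 * \<sigma>)) / (2 * \<sigma> * sinh (sqrt A * t / 2)) *
      exp (- (B * t) / (2 * \<sigma>) - sqrt A * (x + y) / (2 * \<sigma> * tanh (sqrt A * t / 2))) *
      (1 / y * bessel_I \<nu> (sqrt (A * x * y) / (\<sigma> * sinh (sqrt A * t / 2))) +
       0 * bessel_I_neg \<nu> (sqrt (A * x * y) / (\<sigma> * sinh (sqrt A * t / 2)))))"
    unfolding p_def[symmetric] fundamental_solution_def Let_def
  proof (intro allI impI conjI)
    fix \<phi> assume \<phi>: "test_function \<phi>"
    then have \<phi>_cont: "continuous_on {0<..} \<phi>" by (simp add: test_function_def)
    obtain a b where ab: "0 < a" "a \<le> b" and supp: "\<And>y. y \<notin> {a..b} \<Longrightarrow> \<phi> y = 0"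
      using test_function_support[OF \<phi>] by blast
    have sub: "{a..b} \<subseteq> {0<..}" using ab by auto
    \<comment> \<open>The datum together with every factor of p that depends on y alone.\<close>
    define \<rho> where "\<rho> y = \<phi> y * (exp (F y / (2 * \<sigma>)) / y)" for y
    have F_cont_on: "continuous_on {0<..} F"
      by (intro continuous_at_imp_continuous_on) (use F_cont in auto)
    have \<rho>: "continuous_on {a..b} \<rho>"
      unfolding \<rho>_def using ab \<open>\<sigma> > 0\<close>
      by (intro continuous_intros continuous_on_subset[OF \<phi>_cont sub] continuous_on_subset[OF F_cont_on sub]) auto
    have eq: "indicator {0<..} y *\<^sub>R (\<phi> y * p t x y)
        = indicator {a..b} y *\<^sub>R (exp (- F x / (2 * \<sigma>)) * (\<rho> y * Q t x y))"
      if "t > 0" "x > 0" for t x y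
      using p_eq[OF that, of y] supp[of y] ab(1) by (auto simp: \<rho>_def split: split_indicator)
    have int: "set_integrable lborel {a..b} (\<lambda>y. exp (- F x / (2 * \<sigma>)) * (\<rho> y * Q t x y))"
      if "t > 0" "x > 0" for t x
    proof -
      have "continuous_on {a..b} (Q t x)"
        using that by (intro continuous_on_compose2[OF continuous_on_kernels(3)[OF that(2) ab(1) that(1)],
            of _ "\<lambda>y. (x, y)", unfolded case_prod_conv] continuous_intros) auto
      then show ?thesis
        by (intro borel_integrable_atLeastAtMost' continuous_on_mult continuous_on_const \<rho>)
    qed
    show "set_integrable lborel {0<..} (\<lambda>y. \<phi> y * p t x y)" if "t > 0" "x > 0" for t x
      using int[OF that] unfolding set_integrable_def eq[OF that] .
    have u: "(LINT y:{0<..}|lborel. \<phi> y * p t x y)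
        = exp (- F x / (2 * \<sigma>)) * integral {a..b} (\<lambda>y. \<rho> y * Q t x y)" if "t > 0" "x > 0" for t x
    proof -
      have "(LINT y:{0<..}|lborel. \<phi> y * p t x y)
          = (LINT y:{a..b}|lborel. exp (- F x / (2 * \<sigma>)) * (\<rho> y * Q t x y))"
        unfolding set_lebesgue_integral_def eq[OF that] ..
      then show ?thesis
        by (simp only: set_borel_integral_eq_integral(2)[OF int[OF that]]
            Henstock_Kurzweil_Integration.integral_mult_right)
    qed
    note pde = pde_integral[OF \<rho> ab(1), unfolded \<kappa>]
    show "solves_pde \<sigma> f \<mu> (\<lambda>t x. LINT y:{0<..}|lborel. \<phi> y * p t x y)"
    proof (rule solves_pde_cong)
      show "solves_pde \<sigma> f \<mu> (\<lambda>t x. exp (- F x / (2 * \<sigma>)) * integral {a..b} (\<lambda>y. \<rho> y * Q t x y))"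
        by (rule solves_pde_gauge[OF \<open>\<sigma> > 0\<close> riccati F pde])
    qed (rule u)
    fix x0 :: real assume x0: "x0 > 0"
    let ?F = "at (0, x0) within {0<..} \<times> {0<..} :: (real \<times> real) filter"
    \<comment> \<open>The counterpart of \<rho> for \<open>D\<close> instead of \<open>Q\<close>,
      with the compensating power of y from \<open>Q_eq_D\<close>.\<close>
    define \<psi> where "\<psi> y = \<phi> y * (exp (F y / (2 * \<sigma>)) * y powr - ((1 + \<nu>) / 2))" for y
    have \<psi>_cont: "continuous_on {0<..} \<psi>"
      unfolding \<psi>_def using \<open>\<sigma> > 0\<close>
      by (intro continuous_intros \<phi>_cont F_cont_on) auto
    \<comment> \<open>F is uncontrolled for y <= 0; restricting \<psi> to its support gives
      measurability on the whole line from continuity on {a..b}.\<close>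
    have \<psi>_supp: "\<psi> = (\<lambda>y. indicator {a..b} y *\<^sub>R \<psi> y)"
      using supp by (auto simp: \<psi>_def fun_eq_iff split: split_indicator)
    have \<psi>_meas: "\<psi> \<in> borel_measurable borel"
      by (subst \<psi>_supp, rule borel_measurable_continuous_on_indicator)
        (use continuous_on_subset[OF \<psi>_cont sub] in auto)
    have "bounded (\<psi> ` {a..b})"
      by (intro compact_imp_bounded compact_continuous_image continuous_on_subset[OF \<psi>_cont sub] compact_Icc)
    then obtain K where K: "K > 0" "\<And>y. y \<in> {a..b} \<Longrightarrow> \<bar>\<psi> y\<bar> \<le> K"
      by (auto simp: bounded_pos)
    have \<psi>_bound: "\<bar>\<psi> y\<bar> \<le> K" for y
      using K supp[of y] by (cases "y \<in> {a..b}") (auto simp: \<psi>_def)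
    have \<psi>_isCont: "isCont \<psi> x0"
      using \<psi>_cont x0 by (simp add: continuous_on_eq_continuous_at)
    have fst: "(fst \<longlongrightarrow> 0) ?F" and snd: "(snd \<longlongrightarrow> x0) ?F"
      by (auto intro!: tendsto_eq_intros)
    have "((\<lambda>q. exp (- F (snd q) / (2 * \<sigma>)) * (exp (- B * fst q / (2 * \<sigma>)) * snd q powr ((1 + \<nu>) / 2))
        * (LINT y|lborel. \<psi> y * D q y)) \<longlongrightarrow>
      exp (- F x0 / (2 * \<sigma>)) * (exp (- B * 0 / (2 * \<sigma>)) * x0 powr ((1 + \<nu>) / 2)) * \<psi> x0) ?F"
      using x0 \<open>\<sigma> > 0\<close>
      by (intro tendsto_intros fst snd tendsto_integral_D[OF \<beta> x0 \<psi>_meas \<psi>_bound \<psi>_isCont]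
          isCont_tendsto_compose[OF F_cont[OF x0]]) auto
    \<comment> \<open>The factors outside the integral, evaluated at x0, are inverse to those that
      \<psi> attaches to \<phi>.\<close>
    also have "exp (- F x0 / (2 * \<sigma>)) * (exp (- B * 0 / (2 * \<sigma>)) * x0 powr ((1 + \<nu>) / 2)) * \<psi> x0
        = \<phi> x0 * (exp (- F x0 / (2 * \<sigma>)) * exp (F x0 / (2 * \<sigma>)))
          * (x0 powr ((1 + \<nu>) / 2) * x0 powr - ((1 + \<nu>) / 2))"
      by (simp add: \<psi>_def mult_ac)
    also have "\<dots> = \<phi> x0"
      using x0 by (simp flip: exp_add powr_add)
    finally have lim: "((\<lambda>q. exp (- F (snd q) / (2 * \<sigma>)) * (exp (- B * fst q / (2 * \<sigma>)) * snd q powr ((1 + \<nu>) / 2))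
        * (LINT y|lborel. \<psi> y * D q y)) \<longlongrightarrow> \<phi> x0) ?F" .
    show "((\<lambda>(t, x). LINT y:{0<..}|lborel. \<phi> y * p t x y) \<longlongrightarrow> \<phi> x0) ?F"
    proof (rule Lim_transform_eventually[OF lim])
      have "eventually (\<lambda>q. fst q > 0 \<and> snd q > 0) ?F"
        unfolding eventually_at_filter by (intro always_eventually) auto
      then show "eventually (\<lambda>q. exp (- F (snd q) / (2 * \<sigma>)) * (exp (- B * fst q / (2 * \<sigma>)) * snd q powr ((1 + \<nu>) / 2))
          * (LINT y|lborel. \<psi> y * D q y) = (case q of (t, x) \<Rightarrow> LINT y:{0<..}|lborel. \<phi> y * p t x y)) ?F"
      proof eventually_elim
        case (elim q)
        obtain t x where q: "q = (t, x)" by force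
        with elim have tx: "t > 0" "x > 0" by auto
        let ?c = "exp (- F x / (2 * \<sigma>)) * (exp (- B * t / (2 * \<sigma>)) * x powr ((1 + \<nu>) / 2))"
        \<comment> \<open>For y <= 0 both sides vanish because \<phi> does, so the restricted
          integral equals the integral over the line.\<close>
        have "indicator {0<..} y *\<^sub>R (\<phi> y * p t x y) = ?c * (\<psi> y * D (t, x) y)" for y
        proof (cases "y > 0")
          case True
          have "p t x y = exp (- F x / (2 * \<sigma>)) * (exp (F y / (2 * \<sigma>)) * (Q t x y / y))"
            using p_eq[OF tx True] by simp
          then show ?thesis
            unfolding Q_eq_D[OF tx True] using True by (simp add: \<psi>_def mult_ac)
        qed (use supp[of y] ab(1) in \<open>auto simp: \<psi>_def\<close>)
        then show ?case
          unfolding q set_lebesgue_integral_def by simp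
      qed
    qed
  qed
qed

end
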